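(* Let $i\in\{0,\dots,r\}$ and suppose that $\boldsymbol m,\boldsymbol l,k$ and $\boldsymbol m,\boldsymbol l+\boldsymbol 1_i,k+1$ are consistent parameters. Then the operator $D_i(\boldsymbol l,k)$ maps $V(\boldsymbol l,k)$ to $V(\boldsymbol l+\boldsymbol 1_i,k+1)$, and $$D_i(\boldsymbol l,k):\ V(\boldsymbol l,k)\to V(\boldsymbol l+\boldsymbol 1_i,k+1)$$ is an isomorphism of vector spaces.
   Context: Fix an integer $r\ge1$ and a sequence $\boldsymbol m=(m_1,\dots,m_r)$ of non-negative integers. For $\boldsymbol l=(l_1,\dots,l_r)$ and $k$ put $l_0=k$, $l_{r+1}=0$. The parameters $\boldsymbol m,\boldsymbol l,k$ are consistent if all $m_i,l_i,k$ are non-negative integers, $k\ge l_1\ge\dots\ge l_r\ge0$ and $l_s-l_{s+1}\le m_s$ for $s=1,\dots,r$. Put $e_i(\boldsymbol l,k)=k+\sum_{s=1}^im_s-l_i+l_{i+1}+i$, $i=0,\dots,r$. For consistent parameters, $V(\boldsymbol l,k)=V(\boldsymbol m,\boldsymbol l,k)$ is the unique $(r+1)$-dimensional complex vector space of polynomials in $x$ such that the set of degrees of its non-zero elements is $\{e_0<\dots<e_r\}$, the set of orders of vanishing at $x=0$ of its non-zero elements is $\{i+\sum_{s=1}^i m_s: i=0,\dots,r\}$, and the set of orders of vanishing at $x=1$ is $\{0,k+1,k+2,\dots,k+r\}$ (existence and uniqueness are known; for parameters that are not consistent no such space exists). $\boldsymbol 1_i=(1,\dots,1,0,\dots,0)\in\mathbb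 Z^r$ has $i$ ones followed by $r-i$ zeros, and $$D_i(\boldsymbol l,k)=x(x-1)\frac{d}{dx}-e_i(\boldsymbol l,k)(x-1)-k-1 .$$ *)

theory Defs
  imports Complex_Main "HOL-Computational_Algebra.Polynomial"
begin

interpretation cpoly: vector_space "smult :: complex \<Rightarrow> complex poly \<Rightarrow> complex poly"
  by unfold_locales (simp_all add: smult_add_right smult_add_left)

text \<open>
  A sequence $(a_1,\dots,a_r)$ of non-negative integers is a function on \<open>nat\<close> of which only
  the values at the indices \<open>1, \<dots>, r\<close> are used; \<open>r\<close> is passed explicitly.
  Non-negativity of all parameters is built into the type.
\<close>

text \<open>The sequence \<open>l\<close> extended by $l_0 = k$ and $l_{r+1} = 0$.\<close>

definition l_ext :: "nat \<Rightarrow> (nat \<Rightarrow> nat) \<Rightarrow> nat \<Rightarrow> nat \<Rightarrow> nat" where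
  "l_ext r l k s = (if s = 0 then k else if s \<le> r then l s else 0)"

definition consistent :: "nat \<Rightarrow> (nat \<Rightarrow> nat) \<Rightarrow> (nat \<Rightarrow> nat) \<Rightarrow> nat \<Rightarrow> bool" where
  "consistent r m l k \<longleftrightarrow>
     (\<forall>s\<in>{0..r}. l_ext r l k s \<ge> l_ext r l k (Suc s)) \<and>
     (\<forall>s\<in>{1..r}. int (l_ext r l k s) - int (l_ext r l k (Suc s)) \<le> int (m s))"

definition e :: "nat \<Rightarrow> (nat \<Rightarrow> nat) \<Rightarrow> (nat \<Rightarrow> nat) \<Rightarrow> nat \<Rightarrow> nat \<Rightarrow> int" where
  "e r m l k i =
     int k + (\<Sum>s=1..i. int (m s)) - int (l_ext r l k i) + int (l_ext r l k (Suc i)) + int i"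

text \<open>
  Since \<open>cpoly.dim\<close> is \<open>0\<close> on infinite-dimensional spaces, \<open>cpoly.dim W = r + 1\<close> forces finite
  dimension.
\<close>

definition is_V :: "nat \<Rightarrow> (nat \<Rightarrow> nat) \<Rightarrow> (nat \<Rightarrow> nat) \<Rightarrow> nat \<Rightarrow> complex poly set \<Rightarrow> bool" where
  "is_V r m l k W \<longleftrightarrow>
     cpoly.subspace W \<and> cpoly.dim W = r + 1 \<and>
     (\<lambda>p. int (degree p)) ` (W - {0}) = e r m l k ` {0..r} \<and>
     order 0 ` (W - {0}) = (\<lambda>i. i + (\<Sum>s=1..i. m s)) ` {0..r} \<and>
     order 1 ` (W - {0}) = insert 0 {k + 1..k + r}"

text \<open>
  For consistent parameters there is exactly one space with these properties; \<open>V\<close> is meaningful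
  only in that case.
\<close>

definition V :: "nat \<Rightarrow> (nat \<Rightarrow> nat) \<Rightarrow> (nat \<Rightarrow> nat) \<Rightarrow> nat \<Rightarrow> complex poly set" where
  "V r m l k = (THE W. is_V r m l k W)"

definition ones :: "nat \<Rightarrow> nat \<Rightarrow> nat" where
  "ones i s = (if 1 \<le> s \<and> s \<le> i then 1 else 0)"

text \<open>$D_i = x(x-1)\,\frac{d}{dx} - e_i\,(x-1) - k - 1$, acting on polynomials.\<close>

definition D ::
  "nat \<Rightarrow> (nat \<Rightarrow> nat) \<Rightarrow> (nat \<Rightarrow> nat) \<Rightarrow> nat \<Rightarrow> nat \<Rightarrow> complex poly \<Rightarrow> complex poly" where
  "D r m l k i p =
     [:0, 1:] * [:-1, 1:] * pderiv p - smult (of_int (e r m l k i)) ([:-1, 1:] * p)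
       - smult (of_nat k + 1) p"

end

theory Submission
  imports Defs "HOL-Computational_Algebra.Polynomial_FPS"
begin

text \<open>
  Put $a_j = j + m_1 + ... + m_j$ and $d_j = l_j - l_{j+1}$ for $0 \le j \le r$. Then
  $d_0 + ... + d_r = k$, $e_j = a_j + k - d_j$, and consistency means $d_j \ge 0$ together with
  $a_{j-1} < a_j - d_j$ for $j \ge 1$. Hence the $k$ integers $a_j - s$ with $1 \le s \le d_j$ are pairwise
  distinct; let $\phi$ be the monic polynomial of degree $k$ with these zeros. The space
  $V(l,k)$ is of hypergeometric type and has the explicit basis
  $$P_j = (1-x)^{k+1} \sum_{N \ge a_j} \phi(N) x^N, \qquad 0 \le j \le r.$$

  In this basis the theorem is a one-line computation. Writing $p = (1-x)^{k+1} f$ gives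
  $D_i p = -(1-x)^{k+2} (x f' - (e_i-k-1) f)$ (\<open>fps_of_D\<close>), so $D_i$ multiplies the $N$-th
  coefficient of $f$ by $-(N - (a_i - d_i - 1))$. The step from $(l,k)$ to $(l + 1_i, k+1)$ raises
  $d_i$ by one and keeps the other $d_j$ and all $a_j$, so it adds to $\phi$ exactly the factor
  $N - (a_i - d_i - 1)$. Thus $D_i$ maps $P_j$ to minus the $j$-th basis polynomial of the target.

  The work lies in showing that the span of the $P_j$ is the space \<open>V\<close>, which is
  defined by unique existence.

  \<^item> The span has the right exponents (\<open>has_exponents_V_span\<close>). That $P_j$ is a polynomial of
  degree $e_j$ rests on the theory of generating functions of polynomial sequences:
  $(1-x)^{k+1} \sum_{N \ge 0} p(N) x^N$ is a polynomial of degree at most $k$ if $\deg p \le k$, and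
  its degree drops by one for each of the zeros $-1, -2, ...$ of $p$ up to the first non-zero. The
  order of $P_j$ at $0$ is read off. At $1$, an element of the span that vanishes there is
  $(1-x)^{k+1} u$, where $u$ is a polynomial whose coefficients obey a two-term recurrence. The
  recurrence forces $u = 0$ as soon as $u$ vanishes to order $r$ at $1$
  (\<open>recurrence_order_1\<close>); so only the $r+1$ orders $0, k+1, ..., k+r$ are possible, and a space
  of dimension $r+1$ attains all of them.

  \<^item> No other space has these exponents (\<open>has_exponents_unique\<close>). By counting dimensions such a
  space contains for each $j$ some $p_j = x^{a_j} q_j$ with $\deg q_j \le k - d_j$; it does not
  vanish at $1$ and may be scaled to $p_j(1) = 1$. By the converse of the degree statement above,
  $p_j = (1-x)^{k+1} \sum_{N \ge a_j} \psi_j(N) x^N$ with $\deg \psi_j \le k$ and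
  $\psi_j$ vanishing at $a_j - 1, ..., a_j - d_j$. The difference of two $p_j$ vanishes
  at $1$, hence is divisible by $(1-x)^{k+1}$, and this makes all $\psi_j$ equal. The common
  polynomial vanishes at all zeros of $\phi$, so it is a multiple of $\phi$.
\<close>

section \<open>Generating functions of polynomial sequences\<close>

definition backward_diff :: "'a::field_char_0 poly \<Rightarrow> 'a poly" where
  "backward_diff p = p - pcompose p [:-1, 1:]"

lemma poly_backward_diff: "poly (backward_diff p) x = poly p x - poly p (x - 1)"
  by (simp add: backward_diff_def poly_pcompose)

lemma coeff_shift_top:
  fixes p :: "'a::field_char_0 poly"
  assumes "degree p \<le> n"
  shows "coeff (pcompose p [:c, 1:]) n = coeff p n"
proof (cases "degree p = n")
  case True
  then show ?thesis
    using lead_coeff_comp[of "[:c, 1:]" p] by (simp add: degree_pcompose)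
next
  case False
  then show ?thesis
    using assms by (simp add: coeff_eq_0 degree_pcompose)
qed

lemma backward_diff_degree_coeff:
  "degree p \<le> Suc n \<Longrightarrow> degree (backward_diff p) \<le> n \<and> coeff (backward_diff p) n = of_nat (Suc n) * coeff p (Suc n)"
proof (induction p arbitrary: n)
  case 0
  then show ?case by (simp add: backward_diff_def)
next
  case (pCons a p)
  have dp: "degree p \<le> n" using pCons.prems pCons.hyps by (auto split: if_splits)
  have eq: "backward_diff (pCons a p) = pCons 0 (backward_diff p) + pcompose p [:-1, 1:]"
    by (simp add: backward_diff_def pcompose_pCons algebra_simps)
  show ?case
  proof (cases n)
    case 0
    then obtain c where "p = [:c:]" using dp degree_0_id by (metis bot_nat_0.extremum_uniqueI)
    then show ?thesis using 0 by (simp add: eq backward_diff_def pcompose_pCons)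
  next
    case (Suc n')
    have IH: "degree (backward_diff p) \<le> n'" "coeff (backward_diff p) n' = of_nat (Suc n') * coeff p (Suc n')"
      using pCons.IH[of n'] dp Suc by auto
    have "degree (pCons 0 (backward_diff p)) \<le> n" using IH(1) Suc by (simp add: degree_pCons_le le_trans)
    moreover have "degree (pcompose p [:-1, 1:]) \<le> n" using dp by (simp add: degree_pcompose)
    ultimately have "degree (backward_diff (pCons a p)) \<le> n" by (simp add: eq degree_add_le)
    then show ?thesis
      using IH(2) Suc coeff_shift_top[OF dp, of "-1"] by (simp add: eq algebra_simps)
  qed
qed

text \<open>
  The monomial of degree $n+1$ has a difference of degree exactly $n$, so the leading term of \<open>q\<close>
  can be removed; the value at \<open>c\<close> is the constant of summation.
\<close>
lemma backward_diff_surj: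
  "\<exists>p. backward_diff p = q \<and> degree p \<le> Suc (degree q) \<and> poly p c = b"
proof (induction "degree q" arbitrary: q b rule: less_induct)
  case less
  define n where "n = degree q"
  define f where "f = monom (lead_coeff q / of_nat (Suc n)) (Suc n)"
  have df: "degree f \<le> Suc n" by (simp add: f_def degree_monom_le)
  have b: "degree (backward_diff f) \<le> n" "coeff (backward_diff f) n = lead_coeff q"
    using backward_diff_degree_coeff[OF df] by (auto simp: f_def simp del: of_nat_Suc)
  show ?case
  proof (cases "degree q = 0")
    case True
    then have "backward_diff f = q" using b n_def
      by (metis bot_nat_0.extremum_uniqueI degree_0_id)
    then have "backward_diff (f + [:b - poly f c:]) = q" by (simp add: backward_diff_def pcompose_add)
    moreover have "degree (f + [:b - poly f c:]) \<le> Suc (degree q)"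
      using df n_def by (intro degree_add_le) auto
    ultimately show ?thesis by (intro exI[of _ "f + [:b - poly f c:]"]) simp
  next
    case False
    define q' where "q' = q - backward_diff f"
    have "degree q' \<le> n" "coeff q' n = 0" using b n_def
      by (auto simp: q'_def intro: degree_diff_le)
    then have "degree q' < degree q" using False n_def
      by (metis coeff_0 le_neq_implies_less leading_coeff_0_iff degree_0)
    from less[OF this, of "b - poly f c"] obtain p
      where "backward_diff p = q'" "degree p \<le> Suc (degree q')" "poly p c = b - poly f c" by blast
    moreover have "backward_diff (p + f) = backward_diff p + backward_diff f" by (simp add: backward_diff_def pcompose_add)
    ultimately show ?thesis using \<open>degree q' < degree q\<close> df n_def
      by (intro exI[of _ "p + f"]) (auto simp: q'_def intro!: degree_add_le)
  qed
qed

definition tail_gf :: "nat \<Rightarrow> 'a::field_char_0 poly \<Rightarrow> 'a fps" where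
  "tail_gf a p = Abs_fps (\<lambda>N. if N < a then 0 else poly p (of_nat N))"

text \<open>
  For \<open>degree p < n\<close> this is the polynomial $(1-x)^n \sum_{N \ge 0} p(N) x^N$. The recursion is
  summation by parts, $(1-x) \sum_N p(N) x^N = p(-1) + \sum_N (p(N) - p(N-1)) x^N$, where $p(-1)$
  compensates the term $N = 0$ of the last sum.
\<close>
primrec gf_numerator :: "nat \<Rightarrow> 'a::field_char_0 poly \<Rightarrow> 'a poly" where
  "gf_numerator 0 p = 0"
| "gf_numerator (Suc n) p = smult (poly p (-1)) ([:1, -1:] ^ n) + gf_numerator n (backward_diff p)"

lemma one_minus_X_mult_nth:
  "fps_nth ((1 - fps_X) * f) n = fps_nth f n - (if n = 0 then 0 else fps_nth (f :: 'a::comm_ring_1 fps) (n - 1))"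
  by (simp add: left_diff_distrib)

lemma fps_of_one_minus_X: "fps_of_poly [:1, -1:] = (1 - fps_X :: 'a::comm_ring_1 fps)"
  by (simp add: fps_of_poly_pCons)

lemma one_minus_X_tail_gf:
  "(1 - fps_X) * tail_gf 0 p = fps_const (poly p (-1)) + tail_gf 0 (backward_diff p)"
  by (intro fps_ext, subst one_minus_X_mult_nth) (auto simp: tail_gf_def poly_backward_diff of_nat_diff Suc_le_eq)

lemma fps_of_gf_numerator:
  "degree p \<le> n \<Longrightarrow> fps_of_poly (gf_numerator (Suc n) p) = (1 - fps_X) ^ Suc n * tail_gf 0 p"
proof (induction n arbitrary: p)
  case 0
  then obtain c where "p = [:c:]" by (metis bot_nat_0.extremum_uniqueI degree_0_id)
  then show ?case using one_minus_X_tail_gf[of p] by (simp add: backward_diff_def tail_gf_def fps_zero_def[symmetric])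
next
  case (Suc n)
  have "(1 - fps_X) ^ Suc (Suc n) * tail_gf 0 p = (1 - fps_X) ^ Suc n * ((1 - fps_X) * tail_gf 0 p)"
    by (simp add: mult_ac)
  also have "\<dots> = fps_const (poly p (-1)) * (1 - fps_X) ^ Suc n + (1 - fps_X) ^ Suc n * tail_gf 0 (backward_diff p)"
    unfolding one_minus_X_tail_gf by (simp only: distrib_left mult.commute)
  also have "(1 - fps_X) ^ Suc n * tail_gf 0 (backward_diff p) = fps_of_poly (gf_numerator (Suc n) (backward_diff p))"
    using Suc.IH[of "backward_diff p"] backward_diff_degree_coeff[OF Suc.prems] by simp
  also have "fps_const (poly p (-1)) * (1 - fps_X) ^ Suc n
      = fps_of_poly (smult (poly p (-1)) ([:1, -1:] ^ Suc n))"
    by (simp only: fps_of_poly_smult fps_of_poly_power fps_of_one_minus_X)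
  also have "\<dots> + fps_of_poly (gf_numerator (Suc n) (backward_diff p)) = fps_of_poly (gf_numerator (Suc (Suc n)) p)"
    by (simp only: gf_numerator.simps(2)[of "Suc n"] fps_of_poly_add)
  finally show ?case by simp
qed

lemma degree_one_minus_X_power: "degree ([:1, -1:] ^ n :: 'a::field_char_0 poly) = n"
  by (simp add: degree_power_eq)

lemma degree_gf_numerator: "degree (gf_numerator (Suc n) p) \<le> n"
proof (induction n arbitrary: p)
  case (Suc n)
  have "degree (gf_numerator (Suc (Suc n)) p) \<le> max (Suc n) n"
    unfolding gf_numerator.simps(2)[of "Suc n"]
    by (intro degree_add_le_max[THEN order_trans] max.mono order_trans[OF degree_smult_le] Suc.IH)
      (simp add: degree_one_minus_X_power del: power_Suc)
  then show ?case by simp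
qed simp

lemma poly_gf_numerator_1: "degree p \<le> n \<Longrightarrow> poly (gf_numerator (Suc n) p) 1 = fact n * coeff p n"
proof (induction n arbitrary: p)
  case 0
  then obtain c where "p = [:c:]" by (metis bot_nat_0.extremum_uniqueI degree_0_id)
  then show ?case by simp
next
  case (Suc n)
  then show ?case using backward_diff_degree_coeff[OF Suc.prems] by simp
qed

text \<open>
  As a rational function $\sum_{N \ge 0} p(N) x^N = - \sum_{N < 0} p(N) x^N$, the right-hand side
  being the expansion at infinity; so the top of the numerator is governed by the values of \<open>p\<close> at
  $-1, -2, ...$. In the induction a zero at $-1$ removes the first term of the recursion and
  shifts the remaining zeros of \<open>p\<close> to zeros of its difference.
\<close>
lemma gf_numerator_reciprocity:
  assumes "d \<le> n" "\<And>s. 1 \<le> s \<Longrightarrow> s \<le> d \<Longrightarrow> poly p (- of_nat s) = 0"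
  shows "degree (gf_numerator (Suc n) p) \<le> n - d \<and>
    coeff (gf_numerator (Suc n) p) (n - d) = (-1) ^ n * poly p (- of_nat (Suc d))"
  using assms
proof (induction d arbitrary: n p)
  case 0
  have "coeff (gf_numerator (Suc n) p) n = (-1) ^ n * poly p (-1)"
  proof -
    have "coeff (gf_numerator n (backward_diff p)) n = 0"
    proof (cases n)
      case (Suc m)
      then show ?thesis using degree_gf_numerator[of m "backward_diff p"] by (intro coeff_eq_0) simp
    qed simp
    moreover have "coeff ([:1, -1:] ^ n :: 'a poly) n = (-1) ^ n"
      using lead_coeff_power[of "[:1, -1::'a:]" n] by (simp add: degree_one_minus_X_power)
    ultimately show ?thesis by simp
  qed
  then show ?case using degree_gf_numerator[of n p] by simp
next
  case (Suc d)
  then obtain m where n: "n = Suc m" "d \<le> m" by (cases n) auto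
  have "poly p (-1) = 0" using Suc.prems(2)[of 1] by simp
  then have eq: "gf_numerator (Suc n) p = gf_numerator (Suc m) (backward_diff p)" using n by simp
  have z: "poly (backward_diff p) (- of_nat s) = 0" if "1 \<le> s" "s \<le> d" for s
  proof -
    have "- of_nat s - 1 = (- of_nat (Suc s) :: 'a)" by simp
    then show ?thesis
      using Suc.prems(2)[of s] Suc.prems(2)[of "Suc s"] that by (simp only: poly_backward_diff) simp
  qed
  have "poly (backward_diff p) (- of_nat (Suc d)) = - poly p (- of_nat (Suc (Suc d)))"
    using Suc.prems(2)[of "Suc d"] by (simp add: poly_backward_diff algebra_simps)
  then show ?case using Suc.IH[OF n(2) z] n(1) unfolding eq by (simp del: gf_numerator.simps)
qed

lemma gf_numerator_degree_imp_zeros: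
  assumes "degree (gf_numerator (Suc n) p) + d \<le> n" "1 \<le> s" "s \<le> d"
  shows "poly p (- of_nat s) = 0"
  using assms(2,3)
proof (induction s rule: less_induct)
  case (less s)
  then have z: "\<And>s'. 1 \<le> s' \<Longrightarrow> s' \<le> s - 1 \<Longrightarrow> poly p (- of_nat s') = 0" by auto
  have "coeff (gf_numerator (Suc n) p) (n - (s - 1)) = (-1) ^ n * poly p (- of_nat (Suc (s - 1)))"
    using gf_numerator_reciprocity[of "s - 1" n p] z assms(1) less.prems by simp
  moreover have "coeff (gf_numerator (Suc n) p) (n - (s - 1)) = 0"
    using assms(1) less.prems by (intro coeff_eq_0) auto
  ultimately show ?case using less.prems by simp
qed

text \<open>
  The recursion can be run backwards: the coefficient of $x^n$ determines $p(-1)$, the rest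
  determines the difference of \<open>p\<close>.
\<close>
lemma gf_numerator_surj: "degree q \<le> n \<Longrightarrow> \<exists>p. degree p \<le> n \<and> gf_numerator (Suc n) p = q"
proof (induction n arbitrary: q)
  case 0
  then obtain c where "q = [:c:]" by (metis bot_nat_0.extremum_uniqueI degree_0_id)
  then show ?case by (intro exI[of _ q]) simp
next
  case (Suc n)
  define c where "c = coeff q (Suc n) * (-1) ^ Suc n"
  define q' where "q' = q - smult c ([:1, -1:] ^ Suc n)"
  have "degree q' \<le> Suc n"
    unfolding q'_def using Suc.prems
    by (intro degree_diff_le order_trans[OF degree_smult_le])
      (simp_all only: degree_one_minus_X_power)
  moreover have "coeff ([:1, -1:] ^ Suc n :: 'a poly) (Suc n) = (-1) ^ Suc n"
    using lead_coeff_power[of "[:1, -1::'a:]" "Suc n"] by (simp only: degree_one_minus_X_power) simp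
  then have "coeff q' (Suc n) = 0"
    unfolding q'_def c_def by (simp del: power_Suc add: mult.assoc flip: power_mult_distrib)
  ultimately have "degree q' \<le> n"
    by (metis coeff_0 degree_0 le_SucE leading_coeff_0_iff zero_le)
  from Suc.IH[OF this] obtain p where p: "degree p \<le> n" "gf_numerator (Suc n) p = q'" by blast
  obtain f where f: "backward_diff f = p" "degree f \<le> Suc (degree p)" "poly f (-1) = c"
    using backward_diff_surj by blast
  then have "gf_numerator (Suc (Suc n)) f = q" using p
    by (simp add: q'_def del: power_Suc gf_numerator.simps(2))
      (simp add: q'_def gf_numerator.simps(2)[of "Suc n"] del: power_Suc)
  then show ?case using f p by (intro exI[of _ f]) simp
qed

lemma one_minus_X_power_dvd_iff:
  "[:1, -1:] ^ n dvd p \<longleftrightarrow> p = 0 \<or> n \<le> order 1 p" for p :: "complex poly"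
proof -
  have "[:1, -1:] ^ n = smult ((-1) ^ n) ([:-1, 1:] ^ n :: complex poly)"
    by (subst smult_power[symmetric]) simp
  then show ?thesis by (simp add: smult_dvd_iff order_divides)
qed

lemma one_minus_X_power_cancel:
  "(1 - fps_X) ^ n * f = (1 - fps_X) ^ n * g \<longleftrightarrow> f = (g :: complex fps)"
proof -
  have "fps_nth (1 - fps_X :: complex fps) 0 \<noteq> 0" by simp
  then have "(1 - fps_X :: complex fps) \<noteq> 0" by (metis fps_zero_nth)
  then show ?thesis by simp
qed

text \<open>Both sides are the product of $y + s$ over $0 \le s \le d$.\<close>
lemma prod_linear_shift:
  "y * (\<Prod>s\<in>{1..d}. y + of_nat s) = (y + of_nat d) * (\<Prod>s\<in>{1..d}. y - 1 + of_nat s)"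
  for y :: "'a::comm_ring_1"
proof (induction d)
  case (Suc d)
  define p where "p = (\<Prod>s\<in>{1..d}. y + of_nat s)"
  define q where "q = (\<Prod>s\<in>{1..d}. y - 1 + of_nat s)"
  have "y * (\<Prod>s\<in>{1..Suc d}. y + of_nat s) = y * p * (y + of_nat (Suc d))"
    by (simp add: p_def mult.assoc)
  also have "\<dots> = (y + of_nat d) * q * (y + of_nat (Suc d))"
    using Suc by (simp only: p_def q_def)
  also have "\<dots> = (y + of_nat (Suc d)) * (q * (y - 1 + of_nat (Suc d)))"
    by (simp add: mult_ac)
  also have "q * (y - 1 + of_nat (Suc d)) = (\<Prod>s\<in>{1..Suc d}. y - 1 + of_nat s)"
    by (simp add: q_def)
  finally show ?case .
qed simp

lemma poly_eq_if_eq_eventually: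
  fixes p q :: "'a::field_char_0 poly"
  assumes "\<And>n. n \<ge> N \<Longrightarrow> poly p (of_nat n) = poly q (of_nat n)"
  shows "p = q"
proof (rule ccontr)
  assume "p \<noteq> q"
  then have "finite {x. poly (p - q) x = 0}" by (intro poly_roots_finite) simp
  moreover have "of_nat ` {N..} \<subseteq> {x. poly (p - q) x = 0}" using assms by auto
  ultimately have "finite (of_nat ` {N..} :: 'a set)" by (rule rev_finite_subset)
  then show False by (simp add: finite_image_iff inj_on_def infinite_Ici)
qed

lemma X_power_tail_gf: "fps_X ^ n * tail_gf 0 p = tail_gf n (pcompose p [:- of_nat n, 1:])"
  by (intro fps_ext) (simp add: tail_gf_def fps_X_power_mult_nth poly_pcompose of_nat_diff)

text \<open>
  Padding with a constant root turns a product of \<open>r + 1\<close> linear factors and a power into a single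
  product, to which the formula for the subleading coefficient applies.
\<close>
lemma prod_linear_pad:
  fixes z :: "'a::field_char_0"
  shows "(\<Prod>i\<le>r + s. [:- (if i \<le> r then f i else z), 1:]) = (\<Prod>i\<le>r. [:- f i, 1:]) * [:- z, 1:] ^ s"
    and "(\<Sum>i\<le>r + s. if i \<le> r then f i else z) = (\<Sum>i\<le>r. f i) + of_nat s * z"
proof (induction s)
  case 0
  {
    case 1
    show ?case by (auto intro!: prod.cong)
  next
    case 2
    show ?case by (auto intro!: sum.cong)
  }
qed (simp_all add: algebra_simps)

lemma pcompose_power: "pcompose (p ^ n) q = pcompose p q ^ n" for p q :: "'a::comm_ring_1 poly"
  by (induction n) (simp_all add: pcompose_mult one_pCons)

section \<open>Moments of a polynomial and its order at one\<close>

text \<open>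
  Moments detect the order at $1$: the functional $u \mapsto (x \, d/dx)^s u$ at $x = 1$ is the moment
  against $N^s$.
\<close>
definition moment :: "'a::field_char_0 poly \<Rightarrow> 'a poly \<Rightarrow> 'a" where
  "moment u g = (\<Sum>N\<le>degree u. coeff u N * poly g (of_nat N))"

lemma moment_eq:
  assumes "degree u \<le> n"
  shows "moment u g = (\<Sum>N\<le>n. coeff u N * poly g (of_nat N))"
  unfolding moment_def using assms
  by (intro sum.mono_neutral_left) (auto simp: coeff_eq_0)

lemma moment_diff: "moment u (g - h) = moment u g - moment u h"
  by (simp add: moment_def algebra_simps sum_subtractf)

lemma moment_smult: "moment u (smult c g) = c * moment u g"
  by (simp add: moment_def algebra_simps sum_distrib_left)

text \<open>
  Multiplying \<open>u\<close> by $1-x$ differences its coefficients; by summation by parts the difference moves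
  to the weight \<open>g\<close>, whose degree drops.
\<close>
lemma moment_one_minus_X_mult:
  "moment ([:1, -1:] * u) g = - moment u (pcompose (backward_diff g) [:1, 1:])"
proof -
  define n where "n = degree u"
  have "degree ([:1, -1:] * u) \<le> Suc n"
    using degree_mult_le[of "[:1, -1:]" u] by (simp add: n_def)
  then have "moment ([:1, -1:] * u) g
      = (\<Sum>N\<le>Suc n. coeff ([:1, -1:] * u) N * poly g (of_nat N))" by (rule moment_eq)
  also have "\<dots> = (\<Sum>N\<le>Suc n. coeff u N * poly g (of_nat N))
      - (\<Sum>N\<le>Suc n. (if N = 0 then 0 else coeff u (N - 1)) * poly g (of_nat N))"
  proof -
    have "coeff ([:1, -1:] * u) N = coeff u N - (if N = 0 then 0 else coeff u (N - 1))" for N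
      by (cases N) (simp_all add: coeff_pCons)
    then show ?thesis by (simp only: left_diff_distrib sum_subtractf)
  qed
  also have "\<dots> = (\<Sum>N\<le>n. coeff u N * poly g (of_nat N)) - (\<Sum>N\<le>n. coeff u N * poly g (of_nat (Suc N)))"
    unfolding sum.atMost_Suc_shift[where g = "\<lambda>N. (if N = 0 then 0 else coeff u (N - 1)) * poly g (of_nat N)"]
    by (simp add: n_def coeff_eq_0 del: of_nat_Suc)
  also have "\<dots> = - moment u (pcompose (backward_diff g) [:1, 1:])"
    by (simp add: moment_def n_def poly_pcompose poly_backward_diff sum_subtractf[symmetric] algebra_simps sum_negf[symmetric])
  finally show ?thesis .
qed

lemma moment_eq_0_if_power_dvd:
  "[:1, -1:] ^ r dvd u \<Longrightarrow> degree g < r \<Longrightarrow> moment u g = 0"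
proof (induction r arbitrary: u g)
  case (Suc r)
  from Suc.prems(1) obtain w where w: "u = [:1, -1:] ^ Suc r * w" by (elim dvdE)
  define v where "v = [:1, -1:] ^ r * w"
  define h where "h = pcompose (backward_diff g) [:1, 1:]"
  have u: "u = [:1, -1:] * v" by (simp only: w v_def power_Suc mult.assoc)
  have "moment v h = 0"
  proof (cases "degree g = 0")
    case True
    then obtain c where "g = [:c:]" by (metis degree_0_id)
    then show ?thesis by (simp add: h_def backward_diff_def moment_def)
  next
    case False
    then have "degree g \<le> Suc (degree g - 1)" by simp
    from backward_diff_degree_coeff[OF this] have "degree h \<le> degree g - 1"
      by (simp add: h_def degree_pcompose)
    then have "degree h < r" using Suc.prems(2) False by linarith
    then show ?thesis by (intro Suc.IH) (simp_all add: v_def)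
  qed
  then show ?case unfolding u moment_one_minus_X_mult by (simp add: h_def)
qed simp

text \<open>A Lagrange interpolation weight isolates one coefficient.\<close>
lemma eq_0_if_all_moments_eq_0:
  assumes "\<And>g. moment u g = 0"
  shows "u = 0"
proof (rule poly_eqI)
  fix N
  show "coeff u N = coeff 0 N"
  proof (cases "N \<le> degree u")
    case True
    define g :: "'a poly" where "g = (\<Prod>i\<in>{..degree u} - {N}. [:- of_nat i, 1:])"
    have "moment u g = (\<Sum>M\<in>{N}. coeff u M * poly g (of_nat M))"
      unfolding moment_def using True
      by (intro sum.mono_neutral_right) (auto simp: g_def poly_prod)
    moreover have "poly g (of_nat N) \<noteq> 0" by (auto simp: g_def poly_prod)
    ultimately show ?thesis using assms[of g] by simp
  qed (simp add: coeff_eq_0)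
qed

lemma coeff_prod_linear:
  fixes c :: "'i \<Rightarrow> 'a::field_char_0"
  assumes "finite I"
  shows "degree (\<Prod>i\<in>I. [:- c i, 1:]) = card I"
    and "coeff (\<Prod>i\<in>I. [:- c i, 1:]) (card I) = 1"
    and "I \<noteq> {} \<Longrightarrow> coeff (\<Prod>i\<in>I. [:- c i, 1:]) (card I - 1) = - (\<Sum>i\<in>I. c i)"
proof -
  have d: "degree (\<Prod>i\<in>I. [:- c i, 1:]) = card I" if "finite I" for I :: "'i set"
    using degree_prod_sum_eq[of I "\<lambda>i. [:- c i, 1:]"] by simp
  have l: "coeff (\<Prod>i\<in>I. [:- c i, 1:]) (card I) = 1" if "finite I" for I :: "'i set"
    using lead_coeff_prod[of "\<lambda>i. [:- c i, 1:]" I] d[OF that] by simp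
  show "degree (\<Prod>i\<in>I. [:- c i, 1:]) = card I" "coeff (\<Prod>i\<in>I. [:- c i, 1:]) (card I) = 1"
    using d l assms by auto
  show "coeff (\<Prod>i\<in>I. [:- c i, 1:]) (card I - 1) = - (\<Sum>i\<in>I. c i)" if "I \<noteq> {}"
    using assms that
  proof (induction I rule: finite_ne_induct)
    case (insert x F)
    then obtain m where m: "card F = Suc m" by (metis card_gt_0_iff gr0_implies_Suc)
    have "coeff (\<Prod>i\<in>insert x F. [:- c i, 1:]) (Suc m)
        = - c x * coeff (\<Prod>i\<in>F. [:- c i, 1:]) (Suc m) + coeff (\<Prod>i\<in>F. [:- c i, 1:]) m"
      using insert by simp
    then show ?case using insert l[of F] m by simp
  qed simp
qed

section \<open>Dimension of a polynomial space through degrees and orders\<close>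

text \<open>
  Only the two identities matter below, so linear forms on polynomials are described by them
  directly instead of through the target space of complex numbers.
\<close>
definition linear_form :: "(complex poly \<Rightarrow> complex) \<Rightarrow> bool" where
  "linear_form f \<longleftrightarrow> (\<forall>p q. f (p + q) = f p + f q) \<and> (\<forall>c p. f (smult c p) = c * f p)"

lemma linear_form_sum:
  assumes "linear_form f"
  shows "f (\<Sum>x\<in>T. smult (u x) (g x)) = (\<Sum>x\<in>T. u x * f (g x))"
proof -
  have "f 0 = 0" using assms unfolding linear_form_def by (metis smult_0_left mult_zero_left)
  then show ?thesis using assms
    by (induction T rule: infinite_finite_induct) (auto simp: linear_form_def)
qed

text \<open>
  In a non-trivial relation, the form belonging to the set of polynomials that occur with non-zero
  coefficient annihilates all of them but one.
\<close>
lemma independent_if_triangular: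
  assumes "\<And>T. T \<subseteq> P \<Longrightarrow> finite T \<Longrightarrow> T \<noteq> {} \<Longrightarrow>
    \<exists>p\<in>T. \<exists>f. linear_form f \<and> f p \<noteq> 0 \<and> (\<forall>q\<in>T - {p}. f q = 0)"
  shows "cpoly.independent P"
  unfolding cpoly.independent_explicit_finite_subsets
proof (intro allI impI)
  fix S u assume S: "S \<subseteq> P" "finite S" "(\<Sum>v\<in>S. smult (u v) v) = 0"
  define T where "T = {v\<in>S. u v \<noteq> 0}"
  have T: "T \<subseteq> P" "finite T" using S by (auto simp: T_def)
  have "(\<Sum>v\<in>T. smult (u v) v) = (\<Sum>v\<in>S. smult (u v) v)"
    unfolding T_def using S by (intro sum.mono_neutral_left) auto
  then have s: "(\<Sum>v\<in>T. smult (u v) v) = 0" using S by simp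
  have "T = {}"
  proof (rule ccontr)
    assume "T \<noteq> {}"
    then obtain p f where p: "p \<in> T" "linear_form f" "f p \<noteq> 0" "\<forall>q\<in>T - {p}. f q = 0"
      using assms[OF T] by blast
    have "0 = f (\<Sum>v\<in>T. smult (u v) v)" using s linear_form_sum[OF p(2), of u _ "{}"] by simp
    also have "\<dots> = (\<Sum>v\<in>T. u v * f v)" by (rule linear_form_sum[OF p(2)])
    also have "\<dots> = (\<Sum>v\<in>{p}. u v * f v)" using p T by (intro sum.mono_neutral_right) auto
    finally show False using p by (auto simp: T_def)
  qed
  then show "\<forall>v\<in>S. u v = 0" by (auto simp: T_def)
qed

lemma linear_form_coeff: "linear_form (\<lambda>p. coeff p n)"
  by (simp add: linear_form_def)

lemma independent_if_inj_degree:
  assumes "inj_on degree P" "0 \<notin> P"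
  shows "cpoly.independent P"
proof (rule independent_if_triangular)
  fix T assume T: "T \<subseteq> P" "finite T" "T \<noteq> {}"
  then have "Max (degree ` T) \<in> degree ` T" by (intro Max_in) auto
  then obtain p where p: "p \<in> T" "degree p = Max (degree ` T)" by auto
  have "coeff q (degree p) = 0" if q: "q \<in> T - {p}" for q
  proof -
    have "degree q \<le> degree p" using p(2) T(2) q by simp
    moreover have "degree q \<noteq> degree p" using assms(1) T(1) p(1) q by (auto simp: inj_on_def)
    ultimately show ?thesis by (intro coeff_eq_0) simp
  qed
  moreover have "coeff p (degree p) \<noteq> 0" using assms(2) T(1) p(1) by auto
  ultimately show "\<exists>p\<in>T. \<exists>f. linear_form f \<and> f p \<noteq> 0 \<and> (\<forall>q\<in>T - {p}. f q = 0)"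
    using p(1) linear_form_coeff by blast
qed

text \<open>
  The $n$-th Taylor coefficient at \<open>c\<close>, written with a division because the order is defined by
  divisibility.
\<close>
definition taylor_coeff :: "complex \<Rightarrow> nat \<Rightarrow> complex poly \<Rightarrow> complex" where
  "taylor_coeff c n p = poly (p div [:-c, 1:] ^ n) c"

lemma linear_form_taylor: "linear_form (taylor_coeff c n)"
  by (simp add: linear_form_def taylor_coeff_def poly_div_add_left div_smult_left)

lemma taylor_coeff_order:
  assumes "p \<noteq> 0"
  shows "taylor_coeff c (order c p) p \<noteq> 0"
    and "n < order c p \<Longrightarrow> taylor_coeff c n p = 0"
proof -
  obtain q where q: "p = [:-c, 1:] ^ order c p * q" "\<not> [:-c, 1:] dvd q"
    using order_decomp[OF assms] by blast
  have "p div [:-c, 1:] ^ order c p = q"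
    by (subst q(1)) (rule nonzero_mult_div_cancel_left, simp)
  then show "taylor_coeff c (order c p) p \<noteq> 0"
    using q(2) by (simp add: taylor_coeff_def poly_eq_0_iff_dvd)
  show "taylor_coeff c n p = 0" if n: "n < order c p"
  proof -
    obtain m where m: "order c p = n + Suc m" using less_imp_Suc_add[OF n] by auto
    have "p = [:-c, 1:] ^ n * ([:-c, 1:] ^ Suc m * q)"
      using q(1) unfolding m by (simp only: power_add mult.assoc)
    then have "p div [:-c, 1:] ^ n = [:-c, 1:] ^ Suc m * q"
      by (metis nonzero_mult_div_cancel_left pCons_eq_0_iff power_not_zero one_neq_zero)
    then show ?thesis by (simp add: taylor_coeff_def)
  qed
qed

lemma independent_if_inj_order:
  assumes "inj_on (order c) P" "0 \<notin> P"
  shows "cpoly.independent P"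
proof (rule independent_if_triangular)
  fix T assume T: "T \<subseteq> P" "finite T" "T \<noteq> {}"
  then have "Min (order c ` T) \<in> order c ` T" by (intro Min_in) auto
  then obtain p where p: "p \<in> T" "order c p = Min (order c ` T)" by auto
  have "taylor_coeff c (order c p) q = 0" if q: "q \<in> T - {p}" for q
  proof -
    have "order c p \<le> order c q" using p(2) T(2) q by simp
    moreover have "order c q \<noteq> order c p" using assms(1) T(1) p(1) q by (auto simp: inj_on_def)
    moreover have "q \<noteq> 0" using q T(1) assms(2) by auto
    ultimately show ?thesis by (intro taylor_coeff_order(2)) auto
  qed
  moreover have "taylor_coeff c (order c p) p \<noteq> 0"
    using assms(2) T(1) p(1) by (intro taylor_coeff_order(1)) auto
  ultimately show "\<exists>p\<in>T. \<exists>f. linear_form f \<and> f p \<noteq> 0 \<and> (\<forall>q\<in>T - {p}. f q = 0)"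
    using p(1) linear_form_taylor by blast
qed

text \<open>
  The finitely many forms embed \<open>U\<close> linearly into the span of as many monomials. With coefficients
  or Taylor coefficients as forms, the number of degrees, or of orders at a point, bounds the
  dimension from above; the independence criteria above bound it from below.
\<close>
lemma card_independent_le_if_separating:
  fixes S :: "nat set"
  assumes U: "cpoly.subspace U" and B: "B \<subseteq> U" "cpoly.independent B" and S: "finite S"
    and f: "\<And>n. linear_form (f n)"
    and sep: "\<And>p. p \<in> U \<Longrightarrow> p \<noteq> 0 \<Longrightarrow> \<exists>n\<in>S. f n p \<noteq> 0"
  shows "finite B \<and> card B \<le> card S"
proof -
  define L where "L p = (\<Sum>n\<in>S. monom (f n p) n)" for p
  have L: "coeff (L p) n = (if n \<in> S then f n p else 0)" for p n
    using S by (simp add: L_def coeff_sum)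
  interpret L: Vector_Spaces.linear smult smult L
    using f by unfold_locales (auto simp: poly_eq_iff L linear_form_def smult_add_right smult_add_left)
  have cL: "coeff (L p) n = f n p" if "n \<in> S" for n p
    using that L by simp
  have inj: "inj_on L (cpoly.span B)"
  proof (rule inj_onI)
    fix p q assume pq: "p \<in> cpoly.span B" "q \<in> cpoly.span B" "L p = L q"
    have "p - q \<in> U" using pq(1,2) cpoly.span_minimal[OF B(1) U] U
      by (auto intro: cpoly.subspace_diff)
    moreover have "f n (p - q) = 0" if "n \<in> S" for n
      using cL[OF that, of "p - q"] pq(3) by (simp add: L.diff)
    ultimately show "p = q" using sep[of "p - q"] by auto
  qed
  have "cpoly.independent (L ` B)" by (rule L.independent_injective_image[OF B(2) inj])
  moreover have "L ` B \<subseteq> cpoly.span ((\<lambda>n. monom 1 n) ` S)"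
  proof
    fix x assume "x \<in> L ` B"
    then obtain p where x: "x = (\<Sum>n\<in>S. smult (f n p) (monom 1 n))"
      by (auto simp: L_def smult_monom)
    show "x \<in> cpoly.span ((\<lambda>n. monom 1 n) ` S)"
      unfolding x by (intro cpoly.span_sum cpoly.span_scale cpoly.span_base imageI)
  qed
  ultimately have "finite (L ` B) \<and> card (L ` B) \<le> card ((\<lambda>n. monom 1 n :: complex poly) ` S)"
    using S by (intro cpoly.independent_span_bound) auto
  moreover have "inj_on L B" using inj by (rule inj_on_subset) (rule cpoly.span_superset)
  ultimately show ?thesis
    using card_image_le[OF S, of "\<lambda>n. monom 1 n :: complex poly"]
    by (auto simp: finite_image_iff card_image)
qed

lemma card_independent_le_card_degrees:
  assumes "cpoly.subspace U" "B \<subseteq> U" "cpoly.independent B" "finite (degree ` (U - {0}))"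
  shows "finite B \<and> card B \<le> card (degree ` (U - {0}))"
proof (rule card_independent_le_if_separating[OF assms linear_form_coeff])
  fix p :: "complex poly" assume "p \<in> U" "p \<noteq> 0"
  then show "\<exists>n\<in>degree ` (U - {0}). coeff p n \<noteq> 0" by (intro bexI[of _ "degree p"]) auto
qed

lemma card_independent_le_card_orders:
  assumes "cpoly.subspace U" "B \<subseteq> U" "cpoly.independent B" "finite (order c ` (U - {0}))"
  shows "finite B \<and> card B \<le> card (order c ` (U - {0}))"
proof (rule card_independent_le_if_separating[OF assms linear_form_taylor])
  fix p assume "p \<in> U" "p \<noteq> 0"
  then show "\<exists>n\<in>order c ` (U - {0}). taylor_coeff c n p \<noteq> 0"
    using taylor_coeff_order(1) by (intro bexI[of _ "order c p"]) auto
qed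

text \<open>
  A new value of \<open>v\<close> would come from an element that is independent of \<open>B\<close> and yet lies in its span.
\<close>
lemma image_span_eq_if_inj:
  fixes v :: "complex poly \<Rightarrow> nat"
  assumes ind: "\<And>P. inj_on v P \<Longrightarrow> 0 \<notin> P \<Longrightarrow> cpoly.independent P"
    and B: "finite B" "0 \<notin> B" "inj_on v B" 
  shows "v ` (cpoly.span B - {0}) = v ` B"
proof (rule ccontr)
  assume "\<not> ?thesis"
  moreover have "v ` B \<subseteq> v ` (cpoly.span B - {0})"
    using B(2) by (auto intro!: imageI cpoly.span_base)
  ultimately obtain p where p: "p \<in> cpoly.span B" "p \<noteq> 0" "v p \<notin> v ` B" by blast
  then have "cpoly.independent (insert p B)" using B by (intro ind) auto
  then have "card (insert p B) \<le> card B"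
    using cpoly.independent_span_bound[of B "insert p B"] B p(1) by (auto intro: cpoly.span_base)
  moreover have "p \<notin> B" using p(3) by auto
  ultimately show False using B(1) by simp
qed

section \<open>Exponents and the polynomial phi\<close>

text \<open>
  \<open>a\<close> lists the orders at $0$. The number $d_j$ measures by how much the $j$-th degree falls short
  of $a_j + k$, where $k$ is the sum of the \<open>d j\<close>.
\<close>
locale exponents =
  fixes r :: nat and a d :: "nat \<Rightarrow> nat"
  assumes a_0: "a 0 = 0"
    and gap: "j < r \<Longrightarrow> a j + d (Suc j) < a (Suc j)"
begin

definition k :: nat where "k = (\<Sum>j\<le>r. d j)"

lemma d_le_k: "j \<le> r \<Longrightarrow> d j \<le> k"
  unfolding k_def by (rule member_le_sum) auto

lemma a_gap: "i < j \<Longrightarrow> j \<le> r \<Longrightarrow> a i + d j < a j"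
proof (induction j)
  case (Suc j)
  have "a i \<le> a j" using Suc by (cases "i = j") auto
  then show ?case using gap[of j] Suc.prems by simp
qed simp

lemma a_less: "i < j \<Longrightarrow> j \<le> r \<Longrightarrow> a i < a j"
  using a_gap[of i j] by simp

lemma a_inj: "inj_on a {..r}"
  by (rule strict_mono_on_imp_inj_on) (auto intro!: strict_mono_onI a_less)

definition deg :: "nat \<Rightarrow> nat" where "deg j = a j + k - d j"

lemma deg_less: "i < j \<Longrightarrow> j \<le> r \<Longrightarrow> deg i < deg j"
  using a_gap[of i j] d_le_k[of i] d_le_k[of j] by (simp add: deg_def)

lemma deg_inj: "inj_on deg {..r}"
  by (rule strict_mono_on_imp_inj_on) (auto intro!: strict_mono_onI deg_less)

text \<open>
  The zeros of \<open>phi\<close> fill the integer intervals from $a_j - d_j$ to $a_j - 1$. They are indexed by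
  the pairs $(j,s)$ so that the factors can be counted and a factor can be added.
\<close>
definition zero_index :: "(nat \<times> nat) set" where "zero_index = (SIGMA j:{..r}. {1..d j})"

definition phi_zero :: "nat \<times> nat \<Rightarrow> complex" where "phi_zero = (\<lambda>(j, s). of_nat (a j) - of_nat s)"

definition phi :: "complex poly" where "phi = (\<Prod>i\<in>zero_index. [:- phi_zero i, 1:])"

lemma finite_zero_index: "finite zero_index" by (simp add: zero_index_def)

lemma card_zero_index: "card zero_index = k" by (simp add: zero_index_def k_def)

lemma phi_coeff: "degree phi = k" "coeff phi k = 1"
  using coeff_prod_linear[OF finite_zero_index, of phi_zero] by (simp_all add: phi_def card_zero_index)

lemma phi_zero_int: "phi_zero (j, s) = of_int (int (a j) - int s)" by (simp add: phi_zero_def)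

lemma phi_zero_inj: "inj_on phi_zero zero_index"
proof (rule inj_onI, clarify)
  fix i s j t assume "(i, s) \<in> zero_index" "(j, t) \<in> zero_index" "phi_zero (i, s) = phi_zero (j, t)"
  then have h: "i \<le> r" "1 \<le> s" "s \<le> d i" "j \<le> r" "1 \<le> t" "t \<le> d j" "int (a i) - int s = int (a j) - int t"
    unfolding phi_zero_int of_int_eq_iff by (auto simp: zero_index_def)
  then have "i = j" using a_gap[of i j] a_gap[of j i] by (cases i j rule: linorder_cases) auto
  then show "i = j \<and> s = t" using h by simp
qed

lemma phi_0_iff: "poly phi x = 0 \<longleftrightarrow> (\<exists>j\<le>r. \<exists>s\<in>{1..d j}. x = of_nat (a j) - of_nat s)"
  using finite_zero_index by (auto simp: phi_def poly_prod zero_index_def phi_zero_def)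

lemma phi_int_0_iff:
  "poly phi (of_int z) = 0 \<longleftrightarrow> (\<exists>j\<le>r. int (a j) - int (d j) \<le> z \<and> z < int (a j))"
proof
  assume "poly phi (of_int z) = 0"
  then obtain j s where js: "j \<le> r" "s \<in> {1..d j}" "of_int z = (of_int (int (a j) - int s) :: complex)"
    unfolding phi_0_iff by auto
  then have "z = int (a j) - int s" unfolding of_int_eq_iff by simp
  then show "\<exists>j\<le>r. int (a j) - int (d j) \<le> z \<and> z < int (a j)" using js by auto
next
  assume "\<exists>j\<le>r. int (a j) - int (d j) \<le> z \<and> z < int (a j)"
  then obtain j where j: "j \<le> r" "int (a j) - int (d j) \<le> z" "z < int (a j)" by blast
  then have "nat (int (a j) - z) \<in> {1..d j}"
      "(of_int z :: complex) = of_nat (a j) - of_nat (nat (int (a j) - z))"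
    by auto
  then show "poly phi (of_int z) = 0" using j(1) unfolding phi_0_iff by blast
qed

text \<open>
  No interval of zeros contains a point $a_j$ or a point $a_j - d_j - 1$, because the gap condition
  separates the intervals. The first fact gives the order of the basis polynomials at $0$, the
  second one their degree.
\<close>
lemma phi_a: "j \<le> r \<Longrightarrow> poly phi (of_nat (a j)) \<noteq> 0"
proof
  assume j: "j \<le> r" "poly phi (of_nat (a j)) = 0"
  then obtain i where i: "i \<le> r" "int (a i) - int (d i) \<le> int (a j)" "int (a j) < int (a i)"
    using phi_int_0_iff[of "int (a j)"] by auto
  then show False using a_gap[of j i] a_less[of i j] j(1) by (cases i j rule: linorder_cases) auto
qed

lemma phi_below: "j \<le> r \<Longrightarrow> poly phi (of_int (int (a j) - int (d j) - 1)) \<noteq> 0"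
proof
  assume j: "j \<le> r" "poly phi (of_int (int (a j) - int (d j) - 1)) = 0"
  then obtain i where i: "i \<le> r" "int (a i) - int (d i) \<le> int (a j) - int (d j) - 1"
      "int (a j) - int (d j) - 1 < int (a i)"
    using phi_int_0_iff[of "int (a j) - int (d j) - 1"] by auto
  then show False using a_gap[of j i] a_gap[of i j] j(1) by (cases i j rule: linorder_cases) auto
qed

text \<open>
  The two indicial polynomials of the hypergeometric equation
  $\prod_j (\theta - a_j) f = x \prod_j (\theta - b_j) f$ with $\theta = x \, d/dx$ and
  $b_j = a_j - d_j - 1$, which is satisfied by the power series
  $\sum_{N \ge a_j} \phi(N) x^N$.
\<close>
definition indicial_0 :: "complex poly" where "indicial_0 = (\<Prod>j\<le>r. [:- of_nat (a j), 1:])"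

definition exponent_inf :: "nat \<Rightarrow> complex" where "exponent_inf j = of_nat (a j) - of_nat (d j) - 1"

definition indicial_inf :: "complex poly" where "indicial_inf = (\<Prod>j\<le>r. [:- exponent_inf j, 1:])"

lemma phi_recurrence: "poly indicial_0 x * poly phi x = poly indicial_inf (x - 1) * poly phi (x - 1)"
proof -
  have phi: "poly phi y = (\<Prod>j\<le>r. \<Prod>s\<in>{1..d j}. y - of_nat (a j) + of_nat s)" for y
    unfolding phi_def zero_index_def phi_zero_def poly_prod by (subst prod.Sigma) (auto simp: algebra_simps intro!: prod.cong)
  have "poly indicial_0 x * poly phi x
      = (\<Prod>j\<le>r. (x - of_nat (a j)) * (\<Prod>s\<in>{1..d j}. x - of_nat (a j) + of_nat s))"
    by (simp add: indicial_0_def phi poly_prod prod.distrib)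
  also have "\<dots> = (\<Prod>j\<le>r. (x - of_nat (a j) + of_nat (d j)) * (\<Prod>s\<in>{1..d j}. x - of_nat (a j) - 1 + of_nat s))"
    by (simp only: prod_linear_shift)
  also have "\<dots> = poly indicial_inf (x - 1) * poly phi (x - 1)"
  proof -
    have "poly indicial_inf (x - 1) = (\<Prod>j\<le>r. x - of_nat (a j) + of_nat (d j))"
      by (simp add: indicial_inf_def exponent_inf_def poly_prod algebra_simps)
    moreover have "poly phi (x - 1) = (\<Prod>j\<le>r. \<Prod>s\<in>{1..d j}. x - of_nat (a j) - 1 + of_nat s)"
      by (simp add: phi algebra_simps)
    ultimately show ?thesis by (simp only: prod.distrib)
  qed
  finally show ?thesis .
qed

section \<open>Polynomial solutions of the two-term recurrence\<close>

text \<open>The hypergeometric equation, read off from the coefficients of a polynomial \<open>u\<close>.\<close>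
definition recurrence :: "complex poly \<Rightarrow> bool" where
  "recurrence u \<longleftrightarrow> (\<forall>N. poly indicial_0 (of_nat N) * coeff u N
     = (if N = 0 then 0 else poly indicial_inf (of_nat (N - 1)) * coeff u (N - 1)))"

lemma recurrence_subspace: "recurrence 0" "recurrence u \<Longrightarrow> recurrence v \<Longrightarrow> recurrence (u + v)" "recurrence u \<Longrightarrow> recurrence (smult c u)"
proof -
  show "recurrence 0" by (simp add: recurrence_def)
  show "recurrence (u + v)" if "recurrence u" "recurrence v" for u v
    using that by (simp add: recurrence_def distrib_left)
  show "recurrence (smult c u)" if "recurrence u" for c u
    unfolding recurrence_def
  proof
    fix N
    have "poly indicial_0 (of_nat N) * coeff (smult c u) N = c * (poly indicial_0 (of_nat N) * coeff u N)" by simp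
    also have "poly indicial_0 (of_nat N) * coeff u N
        = (if N = 0 then 0 else poly indicial_inf (of_nat (N - 1)) * coeff u (N - 1))"
      using that unfolding recurrence_def by (rule spec)
    finally show "poly indicial_0 (of_nat N) * coeff (smult c u) N
        = (if N = 0 then 0 else poly indicial_inf (of_nat (N - 1)) * coeff (smult c u) (N - 1))"
      by (cases "N = 0") auto
  qed
qed

lemma indicial_0_eq_0_iff: "poly indicial_0 (of_nat N) = 0 \<longleftrightarrow> N \<in> a ` {..r}"
  by (auto simp: indicial_0_def poly_prod)

definition initial_part :: "nat \<Rightarrow> complex poly" where
  "initial_part j = (\<Sum>N<a j. monom (poly phi (of_nat N)) N)"

lemma coeff_initial_part: "coeff (initial_part j) N = (if N < a j then poly phi (of_nat N) else 0)"
  by (simp add: initial_part_def coeff_sum)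

text \<open>
  Inside its range the truncated series inherits the recurrence from \<open>phi\<close>. The cut is invisible
  because \<open>indicial_0\<close> vanishes exactly at the places $a_j$ where a cut may happen.
\<close>
lemma recurrence_initial_part: "j \<le> r \<Longrightarrow> recurrence (initial_part j)"
  unfolding recurrence_def
proof
  fix N assume j: "j \<le> r"
  show "poly indicial_0 (of_nat N) * coeff (initial_part j) N
      = (if N = 0 then 0 else poly indicial_inf (of_nat (N - 1)) * coeff (initial_part j) (N - 1))"
  proof (cases N)
    case 0
    then show ?thesis using indicial_0_eq_0_iff[of 0] a_0 by force
  next
    case (Suc M)
    have ph: "poly indicial_0 (of_nat N) * poly phi (of_nat N) = poly indicial_inf (of_nat M) * poly phi (of_nat M)"
      using phi_recurrence[of "of_nat N"] Suc by simp
    show ?thesis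
    proof (cases "N = a j")
      case True
      then have "poly indicial_0 (of_nat N) = 0" using indicial_0_eq_0_iff j by auto
      then show ?thesis using ph Suc by (auto simp: coeff_initial_part)
    next
      case False
      then show ?thesis using ph Suc by (auto simp: coeff_initial_part)
    qed
  qed
qed

text \<open>
  Replacing $A(N) u_N$ by $B(N-1) u_{N-1}$ under the sum and shifting the index, where $A$ and $B$ are
  the indicial polynomials.
\<close>
lemma moment_recurrence:
  assumes "recurrence u"
  shows "moment u (g * indicial_0) = moment u (pcompose g [:1, 1:] * indicial_inf)"
proof -
  define n where "n = degree u"
  have "moment u (g * indicial_0) = (\<Sum>N\<le>Suc n. coeff u N * poly (g * indicial_0) (of_nat N))"
    by (rule moment_eq) (simp add: n_def)
  also have "\<dots> = (\<Sum>N\<le>Suc n. poly g (of_nat N) * (if N = 0 then 0 else poly indicial_inf (of_nat (N - 1)) * coeff u (N - 1)))"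
  proof (rule sum.cong[OF refl])
    fix N
    have "poly indicial_0 (of_nat N) * coeff u N
        = (if N = 0 then 0 else poly indicial_inf (of_nat (N - 1)) * coeff u (N - 1))"
      using assms unfolding recurrence_def by (rule spec)
    moreover have "coeff u N * poly (g * indicial_0) (of_nat N) = poly g (of_nat N) * (poly indicial_0 (of_nat N) * coeff u N)"
      by simp
    ultimately show "coeff u N * poly (g * indicial_0) (of_nat N)
        = poly g (of_nat N) * (if N = 0 then 0 else poly indicial_inf (of_nat (N - 1)) * coeff u (N - 1))"
      by (simp only:)
  qed
  also have "\<dots> = (\<Sum>N\<le>n. poly g (of_nat (Suc N)) * (poly indicial_inf (of_nat N) * coeff u N))"
    unfolding sum.atMost_Suc_shift by simp
  also have "\<dots> = moment u (pcompose g [:1, 1:] * indicial_inf)"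
    by (simp add: moment_def n_def poly_pcompose algebra_simps)
  finally show ?thesis .
qed

text \<open>
  A weight of degree exactly $r + s$ whose moment vanishes on every solution of the recurrence. The
  leading terms of the two monic products cancel, and the next coefficient is the difference of the
  sums of roots, $-(k + r + 1 + s) \ne 0$.
\<close>
definition annihilated :: "nat \<Rightarrow> complex poly" where
  "annihilated s = [:0, 1:] ^ s * indicial_0 - [:1, 1:] ^ s * indicial_inf"

lemma annihilated_degree_coeff: "degree (annihilated s) \<le> r + s" "coeff (annihilated s) (r + s) \<noteq> 0"
proof -
  define c where "c i = (if i \<le> r then of_nat (a i) else 0 :: complex)" for i
  define c' where "c' i = (if i \<le> r then exponent_inf i else -1 :: complex)" for i
  define F where "F = (\<Prod>i\<le>r + s. [:- c i, 1:])"
  define G where "G = (\<Prod>i\<le>r + s. [:- c' i, 1:])"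
  have TFG: "annihilated s = F - G"
    using prod_linear_pad(1)[where r = r and s = s and f = "\<lambda>i. of_nat (a i)" and z = "0 :: complex"] prod_linear_pad(1)[where r = r and s = s and f = exponent_inf and z = "-1"]
    by (simp add: annihilated_def F_def G_def c_def c'_def indicial_0_def indicial_inf_def mult.commute)
  have F: "degree F = Suc (r + s)" "coeff F (Suc (r + s)) = 1" "coeff F (r + s) = - (\<Sum>i\<le>r + s. c i)"
    using coeff_prod_linear[of "{..r + s}" c] by (simp_all add: F_def)
  have G: "degree G = Suc (r + s)" "coeff G (Suc (r + s)) = 1" "coeff G (r + s) = - (\<Sum>i\<le>r + s. c' i)"
    using coeff_prod_linear[of "{..r + s}" c'] by (simp_all add: G_def)
  have "degree (annihilated s) \<le> Suc (r + s)" unfolding TFG using F G by (intro degree_diff_le) auto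
  moreover have "coeff (annihilated s) (Suc (r + s)) = 0" using F G by (simp add: TFG)
  ultimately show "degree (annihilated s) \<le> r + s"
    by (metis coeff_0 degree_0 le_SucE leading_coeff_0_iff zero_le)
  have "coeff (annihilated s) (r + s) = (\<Sum>i\<le>r. exponent_inf i) - of_nat s - (\<Sum>i\<le>r. of_nat (a i))"
    using prod_linear_pad(2)[where r = r and s = s and f = "\<lambda>i. of_nat (a i)" and z = "0 :: complex"] prod_linear_pad(2)[where r = r and s = s and f = exponent_inf and z = "-1"]
    by (simp add: TFG F G c_def c'_def)
  also have "\<dots> = - of_nat (k + Suc r + s)"
    by (simp add: exponent_inf_def k_def sum_subtractf)
  finally show "coeff (annihilated s) (r + s) \<noteq> 0" by (simp only: neg_equal_0_iff_equal of_nat_eq_0_iff)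
qed

text \<open>
  Vanishing to order $r$ at $1$ kills all moments of degree below $r$. From degree $r$ on, each
  degree contains a weight \<open>annihilated s\<close> whose moment vanishes as well, so by induction on the
  degree all moments vanish.
\<close>
lemma recurrence_order_1:
  assumes "recurrence u" "[:1, -1:] ^ r dvd u"
  shows "u = 0"
proof (rule eq_0_if_all_moments_eq_0)
  fix g :: "complex poly"
  show "moment u g = 0"
  proof (induction "degree g" arbitrary: g rule: less_induct)
    case less
    show ?case
    proof (cases "degree g < r")
      case True
      then show ?thesis using moment_eq_0_if_power_dvd assms(2) by blast
    next
      case False
      define s where "s = degree g - r"
      have rs: "r + s = degree g" using False by (simp add: s_def)
      have sh: "pcompose ([:0, 1:] ^ s) [:1, 1:] = ([:1, 1:] ^ s :: complex poly)"
        by (simp add: pcompose_power pcompose_pCons)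
      have T0: "moment u (annihilated s) = 0"
        using moment_recurrence[OF assms(1), of "[:0, 1:] ^ s"] by (simp add: annihilated_def moment_diff sh)
      define c where "c = lead_coeff g / coeff (annihilated s) (r + s)"
      define h where "h = g - smult c (annihilated s)"
      have "degree h \<le> degree g" unfolding h_def
        using annihilated_degree_coeff(1)[of s] rs by (intro degree_diff_le order_trans[OF degree_smult_le]) auto
      moreover have "coeff h (degree g) = 0" using annihilated_degree_coeff(2)[of s] rs by (simp add: h_def c_def)
      moreover have "moment u g = moment u h" by (simp add: h_def moment_diff moment_smult T0)
      ultimately show ?thesis
      proof (cases "h = 0")
        case False
        then have "degree h < degree g"
          using \<open>degree h \<le> degree g\<close> \<open>coeff h (degree g) = 0\<close>
          by (metis le_neq_implies_less leading_coeff_0_iff)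
        then show ?thesis using less \<open>moment u g = moment u h\<close> by simp
      qed (simp add: moment_def)
    qed
  qed
qed

section \<open>Existence of the space with given exponents\<close>

text \<open>
  Subtracting the initial part leaves the tail from $a_j$ on, see \<open>fps_of_V_basis\<close>. Written in this
  way the element is visibly a polynomial.
\<close>
definition V_basis :: "nat \<Rightarrow> complex poly" where
  "V_basis j = gf_numerator (Suc k) phi - [:1, -1:] ^ Suc k * initial_part j"

lemma fps_of_V_basis: "fps_of_poly (V_basis j) = (1 - fps_X) ^ Suc k * tail_gf (a j) phi"
proof -
  have "tail_gf 0 phi = tail_gf (a j) phi + fps_of_poly (initial_part j)"
    by (intro fps_ext) (simp add: tail_gf_def coeff_initial_part)
  then show ?thesis
    using fps_of_gf_numerator[of phi k] phi_coeff
    by (simp add: V_basis_def fps_of_poly_diff fps_of_poly_mult fps_of_poly_power fps_of_one_minus_X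
        algebra_simps del: power_Suc gf_numerator.simps)
qed

lemma poly_V_basis_1: "poly (V_basis j) 1 = fact k"
  using poly_gf_numerator_1[of phi k] phi_coeff by (simp add: V_basis_def del: gf_numerator.simps)

lemma V_basis_nonzero: "V_basis j \<noteq> 0"
  using poly_V_basis_1[of j] by auto

lemma order_V_basis: "j \<le> r \<Longrightarrow> order 0 (V_basis j) = a j"
proof -
  assume j: "j \<le> r"
  have t: "subdegree (tail_gf (a j) phi) = a j" using phi_a[OF j] by (intro subdegreeI) (auto simp: tail_gf_def)
  have "fps_nth (1 - fps_X :: complex fps) 0 \<noteq> 0" by simp
  then have "subdegree ((1 - fps_X :: complex fps) ^ Suc k) = 0"
    by (simp add: subdegree_eq_0 fps_power_zeroth del: power_Suc)
  moreover have "(1 - fps_X :: complex fps) ^ Suc k * tail_gf (a j) phi \<noteq> 0"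
    using fps_of_V_basis[of j] V_basis_nonzero[of j] by (metis fps_of_poly_0 fps_of_poly_eq_iff)
  ultimately have "subdegree (fps_of_poly (V_basis j)) = a j"
    using t by (simp add: fps_of_V_basis subdegree_mult del: power_Suc)
  then show ?thesis using subdegree_fps_of_poly V_basis_nonzero by metis
qed

text \<open>
  For $j = 0$ the initial part is empty and reciprocity applies, $-1, ..., -d_0$ being zeros
  of \<open>phi\<close>. For $j > 0$ the initial part dominates; its last non-zero coefficient is at
  $a_j - d_j - 1$.
\<close>
lemma degree_V_basis: "j \<le> r \<Longrightarrow> degree (V_basis j) = deg j"
proof -
  assume j: "j \<le> r"
  define E where "E = gf_numerator (Suc k) phi"
  have z: "poly phi (- of_nat s) = 0" if "1 \<le> s" "s \<le> d 0" for s
    using phi_int_0_iff[of "- int s"] that a_0 by (auto intro!: exI[of _ 0])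
  have "poly phi (- of_nat (Suc (d 0))) \<noteq> 0"
  proof -
    have "- of_nat (Suc (d 0)) = (of_int (int (a 0) - int (d 0) - 1) :: complex)"
      by (simp add: a_0)
    then show ?thesis using phi_below[of 0] by (simp only:) simp
  qed
  moreover have "degree E \<le> k - d 0 \<and> coeff E (k - d 0) = (-1) ^ k * poly phi (- of_nat (Suc (d 0)))"
    unfolding E_def using d_le_k z by (intro gf_numerator_reciprocity) auto
  ultimately have E: "degree E = k - d 0"
    by (intro antisym le_degree) auto
  show ?thesis
  proof (cases "j = 0")
    case True
    then have "initial_part j = 0" using a_0 by (simp add: initial_part_def)
    then show ?thesis using True E a_0 by (simp add: V_basis_def E_def deg_def del: gf_numerator.simps)
  next
    case False
    define n where "n = a j - d j - 1"
    have g: "a 0 + d j < a j" using False j a_gap[of 0 j] by simp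
    then have n: "of_nat n = (of_int (int (a j) - int (d j) - 1) :: complex)"
      by (simp add: n_def of_nat_diff)
    have c: "coeff (initial_part j) n \<noteq> 0" using g phi_below[OF j] by (simp add: coeff_initial_part n) (simp add: n_def)
    have "degree (initial_part j) = n"
    proof (intro antisym degree_le le_degree allI impI c)
      fix i assume "n < i"
      then show "coeff (initial_part j) i = 0"
        using phi_int_0_iff[of "int i"] j g by (auto simp: coeff_initial_part n_def)
    qed
    moreover have "initial_part j \<noteq> 0" using c by auto
    ultimately have "degree ([:1, -1:] ^ Suc k * initial_part j) = Suc k + n"
      by (subst degree_mult_eq) (simp_all add: degree_one_minus_X_power del: power_Suc)
    moreover define M where "M = [:1, -1:] ^ Suc k * initial_part j"
    ultimately have "degree M = Suc k + n" by simp
    then have "degree M = deg j" using g d_le_k[OF j] by (simp add: n_def deg_def)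
    moreover have "degree E < deg j" using E deg_less[of 0 j] False j a_0 by (simp add: deg_def)
    ultimately have "degree (E - M) = deg j"
      using degree_add_eq_right[of E "- M"] by simp
    then show ?thesis by (simp add: V_basis_def E_def M_def del: gf_numerator.simps power_Suc)
  qed
qed

definition has_exponents :: "complex poly set \<Rightarrow> bool" where
  "has_exponents W \<longleftrightarrow> cpoly.subspace W \<and> cpoly.dim W = r + 1 \<and>
     degree ` (W - {0}) = deg ` {..r} \<and>
     order 0 ` (W - {0}) = a ` {..r} \<and>
     order 1 ` (W - {0}) = insert 0 {k + 1..k + r}"

abbreviation V_span :: "complex poly set" where "V_span \<equiv> cpoly.span (V_basis ` {..r})"

lemma inj_order_V_basis: "inj_on (order 0 \<circ> V_basis) {..r}"
  using a_inj by (simp add: inj_on_def order_V_basis)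

lemma inj_degree_V_basis: "inj_on (degree \<circ> V_basis) {..r}"
  using deg_inj by (simp add: inj_on_def degree_V_basis)

lemma card_V_basis: "card (V_basis ` {..r}) = r + 1"
  using inj_on_imageI2[OF inj_order_V_basis] by (simp add: card_image)

lemmas order_inj_V_basis = inj_on_imageI[OF inj_order_V_basis]

lemmas degree_inj_V_basis = inj_on_imageI[OF inj_degree_V_basis]

lemma independent_V_basis: "cpoly.independent (V_basis ` {..r})"
  by (rule independent_if_inj_order[OF order_inj_V_basis]) (use V_basis_nonzero in auto)

text \<open>
  All basis polynomials differ from the same numerator by multiples of $(1-x)^{k+1}$, so vanishing
  at $1$ means that the numerator cancels.
\<close>
lemma V_span_form:
  assumes "p \<in> V_span"
  shows "\<exists>x u. p = smult x (gf_numerator (Suc k) phi) - [:1, -1:] ^ Suc k * u \<and> recurrence u"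
proof -
  define E t where "E = gf_numerator (Suc k) phi" and "t = ([:1, -1:] ^ Suc k :: complex poly)"
  define X where "X = {p. \<exists>x u. p = smult x E - t * u \<and> recurrence u}"
  have "cpoly.subspace X"
  proof (rule cpoly.subspaceI)
    show "0 \<in> X" unfolding X_def using recurrence_subspace(1) by (intro CollectI exI[of _ 0]) simp
    show "p + q \<in> X" if "p \<in> X" "q \<in> X" for p q
    proof -
      from that obtain x u y v where *: "p = smult x E - t * u" "recurrence u" "q = smult y E - t * v" "recurrence v"
        unfolding X_def by blast
      have "p + q = smult (x + y) E - t * (u + v)"
        unfolding * by (simp add: algebra_simps smult_add_left)
      then show ?thesis unfolding X_def using recurrence_subspace(2)[OF *(2,4)] by blast
    qed
    show "smult c p \<in> X" if "p \<in> X" for c p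
    proof -
      from that obtain x u where *: "p = smult x E - t * u" "recurrence u"
        unfolding X_def by blast
      have "smult c p = smult (c * x) E - t * smult c u"
        unfolding * by (simp add: smult_diff_right)
      then show ?thesis unfolding X_def using recurrence_subspace(3)[OF *(2)] by blast
    qed
  qed
  moreover have "V_basis ` {..r} \<subseteq> X"
  proof (rule image_subsetI)
    fix j assume "j \<in> {..r}"
    moreover have "V_basis j = smult 1 E - t * initial_part j" by (simp add: V_basis_def E_def t_def del: gf_numerator.simps power_Suc)
    ultimately show "V_basis j \<in> X" unfolding X_def using recurrence_initial_part by blast
  qed
  ultimately have "V_span \<subseteq> X" by (intro cpoly.span_minimal)
  then show ?thesis using assms unfolding X_def E_def t_def by blast
qed

lemma order_1_V_span:
  assumes "p \<in> V_span" "p \<noteq> 0"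
  shows "order 1 p \<in> insert 0 {k + 1..k + r}"
proof (cases "poly p 1 = 0")
  case True
  obtain x u where xu: "p = smult x (gf_numerator (Suc k) phi) - [:1, -1:] ^ Suc k * u" "recurrence u"
    using V_span_form[OF assms(1)] by blast
  have "poly p 1 = x * fact k"
    using poly_gf_numerator_1[of phi k] phi_coeff by (simp add: xu(1) del: gf_numerator.simps)
  then have "x = 0" using True by simp
  then have p: "p = [:1, -1:] ^ Suc k * (- u)" using xu(1) by simp
  have u0: "u \<noteq> 0" using p assms(2) by auto
  have "\<not> [:1, -1:] ^ r dvd u" using recurrence_order_1[OF xu(2)] u0 by blast
  then have "order 1 u < r" unfolding one_minus_X_power_dvd_iff by auto
  moreover have "order 1 p = order 1 ([:1, -1:] ^ Suc k :: complex poly) + order 1 u"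
    using p assms(2) by (simp add: order_mult del: power_Suc)
  moreover have "order 1 ([:1, -1:] ^ Suc k :: complex poly) = Suc k"
  proof -
    have "[:1, -1:] ^ Suc k = smult ((-1) ^ Suc k) ([:-1, 1:] ^ Suc k :: complex poly)"
      by (subst smult_power[symmetric]) simp
    then show ?thesis using order_power_n_n[of "1::complex" "Suc k"] by (simp add: order_smult del: power_Suc)
  qed
  ultimately show ?thesis by simp
next
  case False
  then show ?thesis using order_root[of p 1] by simp
qed

text \<open>
  Degrees and orders at $0$ are those of the basis because these are distinct. At $1$ the possible
  orders are at most $r + 1$ in number, so a space of dimension $r + 1$ needs each of them.
\<close>
lemma has_exponents_V_span: "has_exponents V_span"
proof -
  have nz: "0 \<notin> V_basis ` {..r}" using V_basis_nonzero by (metis imageE)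
  have "degree ` (V_span - {0}) = degree ` V_basis ` {..r}"
    by (rule image_span_eq_if_inj[OF independent_if_inj_degree _ nz degree_inj_V_basis]) auto
  moreover have "order 0 ` (V_span - {0}) = order 0 ` V_basis ` {..r}"
    by (rule image_span_eq_if_inj[OF independent_if_inj_order _ nz order_inj_V_basis]) auto
  moreover have "order 1 ` (V_span - {0}) = insert 0 {k + 1..k + r}"
  proof (rule card_seteq)
    show sub: "order 1 ` (V_span - {0}) \<subseteq> insert 0 {k + 1..k + r}"
      by (rule image_subsetI, rule order_1_V_span) auto
    have "card (V_basis ` {..r}) \<le> card (order 1 ` (V_span - {0}))"
      using card_independent_le_card_orders[OF cpoly.subspace_span cpoly.span_superset independent_V_basis
          finite_subset[OF sub]] by simp
    then show "card (insert 0 {k + 1..k + r}) \<le> card (order 1 ` (V_span - {0}))"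
      by (simp add: card_V_basis)
  qed simp
  moreover have "cpoly.dim V_span = r + 1"
    using cpoly.dim_span_eq_card_independent[OF independent_V_basis] card_V_basis by simp
  ultimately show ?thesis
    unfolding has_exponents_def using order_V_basis degree_V_basis by (auto simp: image_image)
qed

section \<open>Uniqueness of the space with given exponents\<close>

text \<open>
  Elements of orders $a_j, ..., a_r$ show that the elements divisible by $x^{a_j}$ form a space of
  dimension at least $r - j + 1$. If all of these had degree above \<open>deg j\<close>, only $r - j$ degrees would
  be left for them.
\<close>
lemma exists_low_degree_high_order:
  assumes W: "has_exponents W" and j: "j \<le> r"
  shows "\<exists>p\<in>W. p \<noteq> 0 \<and> [:0, 1:] ^ a j dvd p \<and> degree p \<le> deg j"
proof (rule ccontr)
  assume neg: "\<not> ?thesis"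
  define U where "U = {p \<in> W. [:0, 1:] ^ a j dvd p}"
  have sW: "cpoly.subspace W" using W by (simp add: has_exponents_def)
  then have sU: "cpoly.subspace U"
    by (auto simp: U_def cpoly.subspace_def intro: dvd_add dvd_smult)
  have degs: "degree ` (U - {0}) \<subseteq> deg ` {j<..r}"
  proof (rule image_subsetI)
    fix p assume p: "p \<in> U - {0}"
    then have "degree p \<in> deg ` {..r}" using W by (auto simp: U_def has_exponents_def)
    then obtain i where i: "i \<le> r" "degree p = deg i" by auto
    have "deg j < deg i" using neg p i(2) by (force simp: U_def)
    then have "j < i" using deg_less[of i j] j by (cases i j rule: linorder_cases) auto
    then show "degree p \<in> deg ` {j<..r}" using i by auto
  qed
  have "\<exists>p\<in>W - {0}. order 0 p = a i" if "i \<le> r" for i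
  proof -
    have "a i \<in> order 0 ` (W - {0})" using W that by (simp add: has_exponents_def)
    then show ?thesis by auto
  qed
  then obtain g where "\<And>i. i \<le> r \<Longrightarrow> g i \<in> W - {0} \<and> order 0 (g i) = a i" by metis
  then have g: "g i \<in> W" "g i \<noteq> 0" "order 0 (g i) = a i" if "i \<le> r" for i
    using that by blast+
  have "inj_on a {j..r}" by (rule inj_on_subset[OF a_inj]) auto
  moreover have "(order 0 \<circ> g) i = a i" if "i \<in> {j..r}" for i
    using g(3)[of i] that by simp
  ultimately have inj: "inj_on (order 0 \<circ> g) {j..r}" using inj_on_cong[of "{j..r}" "order 0 \<circ> g" a] by blast
  have "g ` {j..r} \<subseteq> U"
  proof (rule image_subsetI)
    fix i assume i: "i \<in> {j..r}"
    then have "a j \<le> a i" using a_less[of j i] by (cases "i = j") auto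
    then have "[:- 0, 1:] ^ a j dvd g i" unfolding order_divides using g(3)[of i] i by simp
    then show "g i \<in> U" using g(1)[of i] i by (simp add: U_def)
  qed
  moreover have "0 \<notin> g ` {j..r}" using g(2) by (metis atLeastAtMost_iff imageE)
  then have "cpoly.independent (g ` {j..r})"
    by (rule independent_if_inj_order[OF inj_on_imageI[OF inj]])
  ultimately have "card (g ` {j..r}) \<le> card (degree ` (U - {0}))"
    using card_independent_le_card_degrees[OF sU _ _ finite_subset[OF degs]] by simp
  also have "\<dots> \<le> card (deg ` {j<..r})" using degs by (intro card_mono) auto
  also have "\<dots> \<le> r - j" using card_image_le[of "{j<..r}" deg] by simp
  finally show False using inj_on_imageI2[OF inj] j by (simp add: card_image)
qed

lemma vanishing_at_1_dvd:
  assumes "has_exponents W" "p \<in> W" "poly p 1 = 0"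
  shows "[:1, -1:] ^ Suc k dvd p"
proof (cases "p = 0")
  case False
  then have "order 1 p \<in> order 1 ` (W - {0})" using assms(2) by simp
  then have "order 1 p \<in> insert 0 {k + 1..k + r}" using assms(1) unfolding has_exponents_def by blast
  moreover have "order 1 p \<noteq> 0" using False assms(3) by (simp add: order_root)
  ultimately show ?thesis unfolding one_minus_X_power_dvd_iff by simp
qed simp

text \<open>
  The cofactor $q$ of $x^{a_j}$ has degree at most $k$, so it is the numerator of the generating
  function of a polynomial \<open>chi\<close>, and the degree bound $k - d_j$ makes \<open>chi\<close> vanish at
  $-1, ..., -d_j$. Multiplication by $x^{a_j}$ shifts the argument by $a_j$. The value at $1$ can be
  normalised since otherwise $(1-x)^{k+1}$ would divide $q$.
\<close>
lemma exists_normalized: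
  assumes W: "has_exponents W" and j: "j \<le> r"
  shows "\<exists>p\<in>W. \<exists>psi. poly p 1 = 1 \<and> degree psi \<le> k \<and>
    fps_of_poly p = (1 - fps_X) ^ Suc k * tail_gf (a j) psi \<and>
    (\<forall>s\<in>{1..d j}. poly psi (of_nat (a j) - of_nat s) = 0)"
proof -
  obtain p where p: "p \<in> W" "p \<noteq> 0" "[:0, 1:] ^ a j dvd p" "degree p \<le> deg j"
    using exists_low_degree_high_order[OF assms] by blast
  then obtain q where q: "p = [:0, 1:] ^ a j * q" by (elim dvdE)
  have q0: "q \<noteq> 0" using p(2) q by auto
  have dq: "degree q + d j \<le> k"
  proof -
    have "degree p = a j + degree q"
      using q0 by (simp add: q degree_mult_eq degree_linear_power)
    then show ?thesis using p(4) d_le_k[OF j] by (simp add: deg_def)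
  qed
  have p1: "poly p 1 \<noteq> 0"
  proof
    assume "poly p 1 = 0"
    then have "[:1, -1:] ^ Suc k dvd p" using vanishing_at_1_dvd[OF W p(1)] by simp
    then have "Suc k \<le> order 1 p" using p(2) unfolding one_minus_X_power_dvd_iff by simp
    also have "order 1 p = order 1 ([:0, 1:] ^ a j :: complex poly) + order 1 q"
      using p(2) unfolding q by (rule order_mult)
    also have "order 1 ([:0, 1:] ^ a j :: complex poly) = 0" by (intro order_0I) simp
    also have "0 + order 1 q \<le> degree q" using order_degree[OF q0] by simp
    finally show False using dq by simp
  qed
  define c where "c = inverse (poly p 1)"
  have dcq: "degree (smult c q) + d j \<le> k" using dq degree_smult_le[of c q] by linarith
  then obtain chi where chi: "degree chi \<le> k" "gf_numerator (Suc k) chi = smult c q"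
    using gf_numerator_surj[of "smult c q" k] by (metis add_leD1)
  have zeros: "poly chi (- of_nat s) = 0" if "1 \<le> s" "s \<le> d j" for s
    using gf_numerator_degree_imp_zeros[of k chi "d j" s] that dcq unfolding chi(2) by blast
  define psi where "psi = pcompose chi [:- of_nat (a j), 1:]"
  have X: "fps_of_poly ([:0, 1:] :: complex poly) = fps_X" by (simp add: fps_of_poly_pCons)
  have "fps_of_poly (smult c p) = fps_X ^ a j * fps_of_poly (smult c q)"
    by (simp add: q fps_of_poly_mult fps_of_poly_power fps_of_poly_smult X mult_ac)
  also have "\<dots> = (1 - fps_X) ^ Suc k * (fps_X ^ a j * tail_gf 0 chi)"
    unfolding chi(2)[symmetric] fps_of_gf_numerator[OF chi(1)] by (simp only: mult_ac)
  finally have "fps_of_poly (smult c p) = (1 - fps_X) ^ Suc k * tail_gf (a j) psi"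
    by (simp only: X_power_tail_gf psi_def)
  moreover have "degree psi \<le> k" using chi(1) by (simp add: psi_def degree_pcompose)
  moreover have "\<forall>s\<in>{1..d j}. poly psi (of_nat (a j) - of_nat s) = 0"
    using zeros by (simp add: psi_def poly_pcompose)
  moreover have "cpoly.subspace W" using W by (simp add: has_exponents_def)
  then have "smult c p \<in> W" using p(1) by (rule cpoly.subspace_scale)
  moreover have "poly (smult c p) 1 = 1" using p1 by (simp add: c_def)
  ultimately show ?thesis by (intro bexI[of _ "smult c p"] exI[of _ psi] conjI)
qed

lemma multiple_of_phi:
  assumes "degree psi \<le> k" "\<And>i. i \<in> zero_index \<Longrightarrow> poly psi (phi_zero i) = 0"
  shows "\<exists>c. psi = smult c phi"
proof (intro exI)
  define chi where "chi = psi - smult (coeff psi k) phi"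
  have deg: "degree chi \<le> k" "coeff chi k = 0" using assms(1) phi_coeff
    by (auto simp: chi_def intro!: degree_diff_le order_trans[OF degree_smult_le])
  have zeros: "phi_zero ` zero_index \<subseteq> {x. poly chi x = 0}"
    using assms(2) finite_zero_index by (auto simp: chi_def phi_def poly_prod)
  have "chi = 0"
  proof (rule ccontr)
    assume nz: "chi \<noteq> 0"
    have "k = card (phi_zero ` zero_index)" using phi_zero_inj by (simp add: card_image card_zero_index)
    also have "\<dots> \<le> card {x. poly chi x = 0}"
      using zeros poly_roots_finite[OF nz] by (intro card_mono) auto
    also have "\<dots> \<le> degree chi" using nz by (rule card_poly_roots_bound)
    finally show False using deg nz by (metis le_antisym leading_coeff_0_iff)
  qed
  then show "psi = smult (coeff psi k) phi" by (simp add: chi_def)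
qed

text \<open>
  Normalised elements agree modulo $(1-x)^{k+1}$, so their power series after division by
  $(1-x)^{k+1}$ agree from some index on, and their coefficient polynomials are all equal. The
  common polynomial has all zeros of \<open>phi\<close>; hence every \<open>V_basis j\<close> lies in the space, and equality
  follows by dimension.
\<close>
lemma has_exponents_unique:
  assumes W: "has_exponents W"
  shows "W = V_span"
proof -
  have sW: "cpoly.subspace W" and dW: "cpoly.dim W = r + 1"
    using W by (simp_all add: has_exponents_def)
  define Q where "Q j p psi \<longleftrightarrow> p \<in> W \<and> poly p 1 = 1 \<and> degree psi \<le> k \<and>
    fps_of_poly p = (1 - fps_X) ^ Suc k * tail_gf (a j) psi \<and>
    (\<forall>s\<in>{1..d j}. poly psi (of_nat (a j) - of_nat s) = 0)" for j p psi
  have "\<exists>p psi. Q j p psi" if "j \<le> r" for j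
    using exists_normalized[OF W that] unfolding Q_def by blast
  then obtain p psi where "\<And>j. j \<le> r \<Longrightarrow> Q j (p j) (psi j)" by metis
  then have p: "\<And>j. j \<le> r \<Longrightarrow> p j \<in> W" "\<And>j. j \<le> r \<Longrightarrow> poly (p j) 1 = 1"
      "\<And>j. j \<le> r \<Longrightarrow> degree (psi j) \<le> k"
      "\<And>j. j \<le> r \<Longrightarrow> fps_of_poly (p j) = (1 - fps_X) ^ Suc k * tail_gf (a j) (psi j)"
      "\<And>j s. j \<le> r \<Longrightarrow> s \<in> {1..d j} \<Longrightarrow> poly (psi j) (of_nat (a j) - of_nat s) = 0"
    unfolding Q_def by simp_all
  have eq: "psi j = psi 0" if j: "j \<le> r" for j
  proof -
    have "p j - p 0 \<in> W" using p(1) j sW by (intro cpoly.subspace_diff) auto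
    moreover have "poly (p j - p 0) 1 = 0" using p(2) j by simp
    ultimately have "[:1, -1:] ^ Suc k dvd p j - p 0" by (rule vanishing_at_1_dvd[OF W])
    then obtain u where u: "p j - p 0 = [:1, -1:] ^ Suc k * u" by (elim dvdE)
    have "(1 - fps_X) ^ Suc k * (tail_gf (a j) (psi j) - tail_gf (a 0) (psi 0)) = fps_of_poly (p j - p 0)"
      using j by (simp only: p(4) fps_of_poly_diff right_diff_distrib le0)
    also have "\<dots> = (1 - fps_X) ^ Suc k * fps_of_poly u"
      by (simp only: u fps_of_poly_mult fps_of_poly_power fps_of_one_minus_X)
    finally have t: "tail_gf (a j) (psi j) - tail_gf (a 0) (psi 0) = fps_of_poly u"
      unfolding one_minus_X_power_cancel .
    show ?thesis
    proof (rule poly_eq_if_eq_eventually)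
      fix n assume n: "n \<ge> Suc (a j + degree u)"
      have "fps_nth (tail_gf (a j) (psi j) - tail_gf (a 0) (psi 0)) n = 0"
        unfolding t using n by (simp add: coeff_eq_0)
      then show "poly (psi j) (of_nat n) = poly (psi 0) (of_nat n)"
        using n a_0 by (simp add: tail_gf_def)
    qed
  qed
  have "poly (psi 0) (phi_zero i) = 0" if iI: "i \<in> zero_index" for i
  proof -
    obtain j s where "i = (j, s)" "j \<le> r" "s \<in> {1..d j}" using iI by (cases i) (auto simp: zero_index_def)
    then show ?thesis using p(5)[of j s] eq[of j] by (simp add: phi_zero_def)
  qed
  then obtain c where c: "psi 0 = smult c phi" using multiple_of_phi[OF p(3)[of 0]] by auto
  have pP: "p j = smult c (V_basis j)" if j: "j \<le> r" for j
  proof -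
    have "tail_gf (a j) (psi j) = fps_const c * tail_gf (a j) phi"
      by (intro fps_ext) (simp add: tail_gf_def eq[OF j] c)
    then have "fps_of_poly (p j) = fps_of_poly (smult c (V_basis j))"
      unfolding p(4)[OF j] fps_of_poly_smult fps_of_V_basis by (simp only: mult_ac)
    then show ?thesis by (simp only: fps_of_poly_eq_iff)
  qed
  have "c \<noteq> 0" using pP[of 0] p(2)[of 0] by auto
  have PW: "V_basis j \<in> W" if j: "j \<le> r" for j
  proof -
    have "smult (inverse c) (p j) \<in> W" using p(1)[OF j] sW by (intro cpoly.subspace_scale)
    then show ?thesis using pP[OF j] \<open>c \<noteq> 0\<close> by simp
  qed
  then have sub: "V_span \<subseteq> W" using sW by (intro cpoly.span_minimal) auto
  obtain Bs where Bs: "Bs \<subseteq> W" "cpoly.independent Bs" "W \<subseteq> cpoly.span Bs" "card Bs = r + 1"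
    using cpoly.basis_exists[of W] unfolding dW by blast
  have finB: "finite Bs" using Bs(4) card.infinite[of Bs] by linarith
  have "W \<subseteq> V_span"
  proof
    fix x assume x: "x \<in> W"
    show "x \<in> V_span"
    proof (rule ccontr)
      assume nx: "x \<notin> V_span"
      then have "cpoly.independent (insert x (V_basis ` {..r}))"
        using independent_V_basis by (rule cpoly.independent_insertI)
      moreover have "insert x (V_basis ` {..r}) \<subseteq> cpoly.span Bs" using x PW Bs(3) by auto
      ultimately have "card (insert x (V_basis ` {..r})) \<le> card Bs"
        using cpoly.independent_span_bound[OF finB] by blast
      moreover have "x \<notin> V_basis ` {..r}" using nx cpoly.span_superset[of "V_basis ` {..r}"] by auto
      ultimately show False using Bs(4) by (simp add: card_V_basis)
    qed
  qed
  then show ?thesis using sub by blast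
qed

end

section \<open>The action of the operators on the explicit basis\<close>

lemma linear_D: "Vector_Spaces.linear smult smult (D r m l k i)"
  by unfold_locales
    (simp_all add: D_def pderiv_add pderiv_smult algebra_simps smult_add_right smult_diff_right mult.commute)

text \<open>
  The factor $(1-x)^{k+1}$ contributes $(k+1) x$ to $x(x-1) \, d/dx$, which combines with the
  term $-(k+1)$ to $(k+1)(x-1)$; so a factor $x-1$ splits off from the whole operator.
\<close>
lemma fps_of_D:
  assumes p: "fps_of_poly p = (1 - fps_X) ^ Suc k * f"
  shows "fps_of_poly (D r m l k i p) = - ((1 - fps_X) ^ Suc (Suc k) *
    (fps_X * fps_deriv f - fps_const (of_int (e r m l k i) - of_nat (Suc k)) * f))"
proof -
  define E c :: "complex fps"
    where "E = fps_const (of_int (e r m l k i))" and "c = fps_const (of_nat (Suc k))"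
  have X: "fps_of_poly ([:0, 1:] :: complex poly) = fps_X"
       "fps_of_poly ([:-1, 1:] :: complex poly) = - (1 - fps_X)"
    by (simp_all add: fps_of_poly_pCons fps_eq_iff)
  have "fps_deriv (1 - fps_X) = (- 1 :: complex fps)" by simp
  then have der: "fps_deriv ((1 - fps_X) ^ Suc k * f) = (1 - fps_X) ^ Suc k * fps_deriv f
      - c * (1 - fps_X) ^ k * f"
    by (simp only: fps_deriv_mult fps_deriv_power c_def[symmetric] diff_Suc_1) simp
  have "D r m l k i p = [:0, 1:] * [:-1, 1:] * pderiv p - smult (of_int (e r m l k i)) ([:-1, 1:] * p)
       - smult (of_nat (Suc k)) p"
    by (simp add: D_def add.commute)
  then have "fps_of_poly (D r m l k i p)
      = fps_X * - (1 - fps_X) * fps_deriv (fps_of_poly p) - E * (- (1 - fps_X) * fps_of_poly p)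
        - c * fps_of_poly p"
    by (simp only: E_def c_def fps_of_poly_diff fps_of_poly_mult fps_of_poly_smult fps_of_poly_pderiv X)
  also have "\<dots> = - ((1 - fps_X) ^ Suc (Suc k) * (fps_X * fps_deriv f - (E - c) * f))"
    unfolding p der by (simp add: algebra_simps)
  finally show ?thesis by (simp only: E_def c_def fps_const_sub)
qed

text \<open>The sum of the $d_j$ telescopes to $l_0 - l_{r+1} = k$.\<close>
lemma is_V_iff_has_exponents:
  fixes a d :: "nat \<Rightarrow> nat"
  assumes "exponents r a d"
    and "\<And>j. j \<le> r \<Longrightarrow> a j = j + (\<Sum>s=1..j. m s)"
    and "\<And>j. j \<le> r \<Longrightarrow> l_ext r l k j = d j + l_ext r l k (Suc j)"
  shows "exponents.k r d = k"
    and "j \<le> r \<Longrightarrow> e r m l k j = int (a j) - int (d j) + int k"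
    and "is_V r m l k W \<longleftrightarrow> exponents.has_exponents r a d W"
proof -
  interpret exponents r a d by fact
  have "j \<le> r \<Longrightarrow> l_ext r l k 0 = (\<Sum>i\<le>j. d i) + l_ext r l k (Suc j)" for j
  proof (induction j)
    case (Suc j)
    then show ?case using assms(3)[of "Suc j"] by simp
  qed (use assms(3)[of 0] in simp)
  from this[of r] show k: "exponents.k r d = k" by (simp add: k_def l_ext_def)
  show e: "e r m l k j = int (a j) - int (d j) + int k" if "j \<le> r" for j
    using assms(2,3)[OF that] by (simp add: e_def)
  have "e r m l k j = int (deg j)" if "j \<le> r" for j
    using e[OF that] d_le_k[OF that] k by (simp add: deg_def)
  then have "e r m l k ` {0..r} = int ` deg ` {..r}"
    by (auto simp: image_image atLeast0AtMost intro!: image_cong)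
  moreover have "(\<lambda>p. int (degree p)) ` (W - {0}) = int ` degree ` (W - {0})"
    by (simp add: image_image)
  moreover have "(\<lambda>i. i + (\<Sum>s=1..i. m s)) ` {0..r} = a ` {..r}"
    using assms(2) by (auto simp: atLeast0AtMost intro!: image_cong)
  ultimately show "is_V r m l k W \<longleftrightarrow> has_exponents W"
    unfolding is_V_def has_exponents_def k by (simp only: inj_image_eq_iff[OF inj_of_nat])
qed

text \<open>
  The step from $a_j$ to $a_{j+1}$ is $m_{j+1} + 1$, so $l_{j+1} - l_{j+2} \le m_{j+1}$ is the gap
  condition.
\<close>
lemma exponents_if_consistent:
  assumes "consistent r m l k"
  shows "exponents r (\<lambda>j. j + (\<Sum>s=1..j. m s)) (\<lambda>j. l_ext r l k j - l_ext r l k (Suc j))"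
proof
  fix j assume "j < r"
  then have "Suc j \<in> {1..r}" by simp
  then have "int (l_ext r l k (Suc j)) - int (l_ext r l k (Suc (Suc j))) \<le> int (m (Suc j))"
    using assms unfolding consistent_def by blast
  then show "j + (\<Sum>s=1..j. m s) + (l_ext r l k (Suc j) - l_ext r l k (Suc (Suc j)))
      < Suc j + (\<Sum>s=1..Suc j. m s)" by simp
qed simp

lemma V_eq_V_span:
  assumes "consistent r m l k"
  shows "V r m l k = exponents.V_span r (\<lambda>j. j + (\<Sum>s=1..j. m s)) (\<lambda>j. l_ext r l k j - l_ext r l k (Suc j))"
proof -
  interpret exponents r "\<lambda>j. j + (\<Sum>s=1..j. m s)" "\<lambda>j. l_ext r l k j - l_ext r l k (Suc j)"
    by (rule exponents_if_consistent) fact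
  have "l_ext r l k j = (l_ext r l k j - l_ext r l k (Suc j)) + l_ext r l k (Suc j)" if "j \<le> r" for j
    using assms that by (simp add: consistent_def)
  from is_V_iff_has_exponents(3)[OF exponents_axioms refl this]
  have "is_V r m l k W \<longleftrightarrow> has_exponents W" for W .
  then show ?thesis unfolding V_def using has_exponents_V_span has_exponents_unique
    by (intro the_equality) blast+
qed

theorem theorem3p3:
  fixes r k i :: nat and m l :: "nat \<Rightarrow> nat"
  assumes "r \<ge> 1" and "i \<in> {0..r}"
    and "consistent r m l k"
    and "consistent r m (\<lambda>s. l s + ones i s) (k + 1)"
  shows "D r m l k i ` V r m l k \<subseteq> V r m (\<lambda>s. l s + ones i s) (k + 1) \<and>
    Vector_Spaces.linear smult smult (D r m l k i) \<and>
    bij_betw (D r m l k i) (V r m l k) (V r m (\<lambda>s. l s + ones i s) (k + 1))"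
proof -
  define l' where "l' = (\<lambda>s. l s + ones i s)"
  define a where "a = (\<lambda>j. j + (\<Sum>s=1..j. m s))"
  define d where "d = (\<lambda>j. l_ext r l k j - l_ext r l k (Suc j))"
  define d' where "d' = (\<lambda>j. l_ext r l' (k + 1) j - l_ext r l' (k + 1) (Suc j))"
  interpret old: exponents r a d
    unfolding a_def d_def by (rule exponents_if_consistent) fact
  interpret new: exponents r a d'
    unfolding a_def d'_def l'_def by (rule exponents_if_consistent) fact
  interpret D: Vector_Spaces.linear smult smult "D r m l k i" by (rule linear_D)
  have i: "i \<le> r" using assms(2) by simp
  have ext: "l_ext r l k j = d j + l_ext r l k (Suc j)" if "j \<le> r" for j
    using assms(3) that by (simp add: d_def consistent_def)
  have ext': "l_ext r l' (k + 1) j = d' j + l_ext r l' (k + 1) (Suc j)" if "j \<le> r" for j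
    using assms(4) that by (simp add: d'_def l'_def consistent_def)
  have k: "old.k = k" and e: "e r m l k i = int (a i) - int (d i) + int k"
    using is_V_iff_has_exponents(1,2)[OF old.exponents_axioms _ ext, of m] i by (auto simp: a_def)
  have k': "new.k = Suc k"
    using is_V_iff_has_exponents(1)[OF new.exponents_axioms _ ext', of m] by (auto simp: a_def)
  \<comment> \<open>Adding ones up to the index \<open>i\<close>, and at $l_0 = k$, changes only the difference at \<open>i\<close>.\<close>
  have d': "d' j = d j + (if j = i then 1 else 0)" if "j \<le> r" for j
  proof -
    have "l_ext r l' (k + 1) s = l_ext r l k s + (if s \<le> i then 1 else 0)" for s
      using i by (auto simp: l_ext_def l'_def ones_def)
    then show ?thesis using ext[OF that] ext'[OF that] by (cases j i rule: linorder_cases) auto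
  qed
  \<comment> \<open>The new zero $a_i - d_i - 1$ of \<open>phi\<close> is the growth exponent $e_i - k - 1$ subtracted by \<open>D\<close>.\<close>
  have "new.zero_index = insert (i, Suc (d i)) old.zero_index"
    using i by (auto simp: new.zero_index_def old.zero_index_def d' split: if_splits)
  moreover have "(i, Suc (d i)) \<notin> old.zero_index" by (simp add: old.zero_index_def)
  ultimately have ins: "new.phi = [:- old.phi_zero (i, Suc (d i)), 1:] * old.phi"
    using old.finite_zero_index by (simp add: new.phi_def old.phi_def)
  have phi: "poly new.phi x = poly old.phi x * (x - of_nat (a i) + of_nat (Suc (d i)))" for x
    unfolding ins by (simp add: old.phi_zero_def algebra_simps)
  have DP: "D r m l k i (old.V_basis j) = - new.V_basis j" if j: "j \<le> r" for j
  proof -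
    define c :: complex where "c = of_int (e r m l k i) - of_nat (Suc k)"
    have c: "c = of_nat (a i) - of_nat (Suc (d i))" by (simp add: c_def e)
    have "fps_X * fps_deriv (tail_gf (a j) old.phi) - fps_const c * tail_gf (a j) old.phi
        = tail_gf (a j) new.phi"
      by (intro fps_ext) (auto simp: tail_gf_def phi c fps_X_mult_nth algebra_simps of_nat_diff)
    then have "fps_of_poly (D r m l k i (old.V_basis j)) = fps_of_poly (- new.V_basis j)"
      using fps_of_D[OF old.fps_of_V_basis[of j, unfolded k], of r m l i]
      by (simp only: fps_of_poly_uminus new.fps_of_V_basis k' c_def)
    then show ?thesis by (simp only: fps_of_poly_eq_iff)
  qed
  have im: "D r m l k i ` old.V_basis ` {..r} = (\<lambda>p. smult (- 1) p) ` new.V_basis ` {..r}"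
    using DP by (auto simp: image_image intro!: image_cong)
  have span: "D r m l k i ` old.V_span = new.V_span"
    unfolding D.span_image[symmetric] im by (rule cpoly.span_image_scale) auto
  moreover have "inj_on (D r m l k i) old.V_span"
  proof -
    \<comment> \<open>The images of the basis still have distinct orders at $0$, hence are independent.\<close>
    have inj: "inj_on (order 0 \<circ> (D r m l k i \<circ> old.V_basis)) {..r}"
      using old.a_inj by (simp add: inj_on_def DP new.order_V_basis)
    have "cpoly.independent ((D r m l k i \<circ> old.V_basis) ` {..r})"
      using DP new.V_basis_nonzero by (intro independent_if_inj_order[OF inj_on_imageI[OF inj]]) auto
    then show ?thesis
      using D.inj_on_span_iff_independent_image[of "old.V_basis ` {..r}"] inj_on_imageI[OF inj_on_imageI2[OF inj]]
      by (simp add: image_comp)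
  qed
  moreover have "V r m l k = old.V_span"
    using V_eq_V_span[OF assms(3)] by (simp only: a_def d_def)
  moreover have "V r m (\<lambda>s. l s + ones i s) (k + 1) = new.V_span"
    using V_eq_V_span[OF assms(4)] by (simp only: a_def d'_def l'_def)
  ultimately show ?thesis using linear_D by (simp add: bij_betw_def)
qed

end
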